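(* For the step set $\mathcal D$, $$Q_{\mathcal D}(x,0,\tfrac12)=2\sum_{n\ge0}(2n+3)B_{2n+2}(-x)^n.$$ In particular: (a) $Q_{\mathcal D}(x,0,\tfrac12)$ is strongly differentially transcendental; (b) its coefficient sequence $(d_n)_{n\ge0}=(1,\tfrac13,\tfrac13,\tfrac35,\tfrac53,\tfrac{691}{105},35,\tfrac{3617}{15},\dots)$, defined by $Q_{\mathcal D}(x,0,\tfrac12)=\sum_{n\ge0}d_nx^n$, satisfies $$4(n+2)(2n+3)\,d_n=\sum_{\ell=0}^{n-1}\binom{2n+4}{2\ell+3}d_\ell d_{n-1-\ell}\quad\text{for all } n\ge1.$$
   Context: Let $\mathbb N=\{0,1,2,\dots\}$ and $\mathcal D=\{(-1,1),(0,1),(1,-1)\}$. $\#_{\mathcal D}\{(0,0)\xrightarrow{n}(i,j)\}$ is the number of sequences $p_0=(0,0),p_1,\dots,p_n=(i,j)$ of points of $\mathbb N^2$ with $p_m-p_{m-1}\in\mathcal D$, and $Q_{\mathcal D}(x,0,\tfrac12)=\sum_{i\ge0}\big(\sum_{n\ge0}\#_{\mathcal D}\{(0,0)\xrightarrow{n}(i,0)\}2^{-n}\big)x^i$ (the inner series converge). Bernoulli numbers: $\sum_{n\ge0}B_n\frac{x^n}{n!}=\frac{x}{e^x-1}$. A power series $f\in\mathbb C[[x]]$ is strongly differentially transcendental if there is no nonzero polynomial $P$ with coefficients in the field $\mathbb C(\{x\})$ of germs at $0$ of meromorphic functions such that $P(f,f',\dots,f^{(m)})=0$ for some $m$. *)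

theory Defs
  imports "HOL-Complex_Analysis.Complex_Analysis"
begin

definition steps_D :: "(int \<times> int) set" where
  "steps_D = {(-1, 1), (0, 1), (1, -1)}"

definition walks_D :: "nat \<Rightarrow> nat \<Rightarrow> nat \<Rightarrow> nat" where
  "walks_D n i j = card {p :: (nat \<times> nat) list.
      length p = Suc n \<and> p ! 0 = (0, 0) \<and> p ! n = (i, j) \<and>
      (\<forall>k<n. (int (fst (p ! Suc k)) - int (fst (p ! k)),
                int (snd (p ! Suc k)) - int (snd (p ! k))) \<in> steps_D)}"

definition dcoeff :: "nat \<Rightarrow> real" where
  "dcoeff i = (\<Sum>n. real (walks_D n i 0) / 2 ^ n)"

definition Q_D :: "complex fps" where
  "Q_D = Abs_fps (\<lambda>i. complex_of_real (dcoeff i))"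

definition bernoulli_num :: "nat \<Rightarrow> real" where
  "bernoulli_num n = fact n * fps_nth (fps_X / (fps_exp 1 - 1)) n"

text \<open>Germs at 0 of meromorphic functions, viewed (via Laurent expansion)
  as a subfield of the formal Laurent series C((x)).\<close>
definition merom_germ :: "complex fls \<Rightarrow> bool" where
  "merom_germ F \<longleftrightarrow> (\<exists>g. g has_laurent_expansion F)"

text \<open>A polynomial in m+1 variables with coefficients c (indexed by exponent
  vectors \<alpha>, \<alpha> i = 0 for i > m, finitely many nonzero), evaluated at
  f, f', ..., f^(m).\<close>
definition diff_poly_eval ::
  "nat \<Rightarrow> ((nat \<Rightarrow> nat) \<Rightarrow> complex fls) \<Rightarrow> complex fps \<Rightarrow> complex fls" where
  "diff_poly_eval m c f = (\<Sum>\<alpha>\<in>{\<alpha>. c \<alpha> \<noteq> 0}.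
      c \<alpha> * (\<Prod>i\<le>m. fps_to_fls ((fps_deriv ^^ i) f) ^ \<alpha> i))"

definition strongly_diff_transcendental :: "complex fps \<Rightarrow> bool" where
  "strongly_diff_transcendental f \<longleftrightarrow>
     \<not> (\<exists>m c. finite {\<alpha>. c \<alpha> \<noteq> 0} \<and>
               (\<forall>\<alpha>. c \<alpha> \<noteq> 0 \<longrightarrow> (\<forall>i>m. \<alpha> i = 0)) \<and>
               (\<forall>\<alpha>. merom_germ (c \<alpha>)) \<and>
               (\<exists>\<alpha>. c \<alpha> \<noteq> 0) \<and>
               diff_poly_eval m c f = 0)"

end

theory Submission
  imports Defs
begin

text \<open>
  The length generating function at $t = 1/2$ satisfies a kernel equation whose kernel curve is
  parametrised by $x = -u^2$, $y = -u^2/(1-u)$. With $v = 1/u$, the coordinate $x$ is invariant under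
  $v \mapsto -v$ and $y$ under $v \mapsto 1 - v$, so $a(v) = u^4 Q(-u^2)$ satisfies a difference
  equation for the shift $v \mapsto v - 1$ with rational right-hand side. Its only formal solution
  without constant term is given by the Bernoulli numbers (up to elementary terms it is the asymptotic series of the second
  derivative of the digamma function, times a constant). The convolution identity then is
  $b^2 = (1-x) b - x b'$ for $b = x/(e^x-1)$.

  For the transcendence, an algebraic relation between the $v$-derivatives of $a$ over the field of
  convergent Laurent series yields, by Ostrowski's argument for the shift, constants $c_i$, not all
  zero, and a shift-invariant (hence constant) difference between $\sum_i c_i\, d^i a/dv^i$ and a
  convergent series. The Borel transform of that sum is $p(x)\, x/(e^x-1)$ for a nonzero polynomial
  $p$; convergence would make it entire, but $p$ cannot vanish at all the points $2\pi i k$.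
\<close>

subsection \<open>Algebraic relations over a subfield\<close>

text \<open>At t = 1/2 the kernel 2xy - x^2 - y^2 - x y^2 has lowest-order part -(x - y)^2: the two
  branches of the curve at the origin merge into a cusp. Hence the two involutions compose to a
  translation of 1/u instead of a multiplication by some q, and x and y are power series in u
  without constant term. All substitutions are therefore formal, which is essential because Q
  diverges: Bernoulli numbers grow factorially. The shift dictates the derivation. d/dv commutes
  with it and d/dx does not, so it is the v-derivatives that satisfy f_i -> f_i + b_i with
  convergent b_i, the form that Ostrowski's argument needs. A relation between x-derivatives of Q is
  pulled back along x = -u^2 and then rewritten by a triangular change of variables; a grading shows
  that it stays nontrivial.\<close>

definition multi_index :: "nat \<Rightarrow> (nat \<Rightarrow> nat) set" where
  "multi_index m = {\<alpha>. \<forall>i>m. \<alpha> i = 0}"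

text \<open>Two gradings are needed: \<open>\<omega> = (\<lambda>_. 1)\<close> is the total degree
  of Ostrowski's argument, and \<open>\<omega> = Suc\<close> orders the derivatives for the
  triangular change of variables.\<close>

definition weight :: "nat \<Rightarrow> (nat \<Rightarrow> nat) \<Rightarrow> (nat \<Rightarrow> nat) \<Rightarrow> nat" where
  "weight m \<omega> \<alpha> = (\<Sum>i\<le>m. \<omega> i * \<alpha> i)"

definition monom_at :: "nat \<Rightarrow> (nat \<Rightarrow> 'a::comm_monoid_mult) \<Rightarrow> (nat \<Rightarrow> nat) \<Rightarrow> 'a" where
  "monom_at m f \<alpha> = (\<Prod>i\<le>m. f i ^ \<alpha> i)"

abbreviation inc :: "(nat \<Rightarrow> nat) \<Rightarrow> nat \<Rightarrow> nat \<Rightarrow> nat" where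
  "inc \<alpha> j \<equiv> \<alpha>(j := Suc (\<alpha> j))"

lemma multi_index_inc: "\<alpha> \<in> multi_index m \<Longrightarrow> j \<le> m \<Longrightarrow> inc \<alpha> j \<in> multi_index m"
  by (auto simp: multi_index_def)

lemma multi_index_add:
  "\<alpha> \<in> multi_index m \<Longrightarrow> \<beta> \<in> multi_index m \<Longrightarrow> (\<lambda>i. \<alpha> i + \<beta> i) \<in> multi_index m"
  by (auto simp: multi_index_def)

lemma weight_inc: "j \<le> m \<Longrightarrow> weight m \<omega> (inc \<alpha> j) = weight m \<omega> \<alpha> + \<omega> j"
  unfolding weight_def by (simp add: sum.remove[of "{..m}" j])

lemma weight_add: "weight m \<omega> (\<lambda>i. \<alpha> i + \<beta> i) = weight m \<omega> \<alpha> + weight m \<omega> \<beta>"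
  by (simp add: weight_def sum.distrib algebra_simps)

lemma monom_at_0 [simp]: "monom_at m f (\<lambda>_. 0) = 1"
  by (simp add: monom_at_def)

lemma monom_at_inc: "j \<le> m \<Longrightarrow> monom_at m f (inc \<alpha> j) = monom_at m f \<alpha> * f j"
  unfolding monom_at_def by (simp add: prod.remove[of "{..m}" j] mult_ac)

lemma monom_at_add: "monom_at m f (\<lambda>i. \<alpha> i + \<beta> i) = monom_at m f \<alpha> * monom_at m f \<beta>"
  by (simp add: monom_at_def power_add prod.distrib)

lemma multi_index_induct [consumes 1, case_names zero inc]:
  assumes "\<alpha> \<in> multi_index m" "P (\<lambda>_. 0)"
    and step: "\<And>\<alpha> j. \<alpha> \<in> multi_index m \<Longrightarrow> j \<le> m \<Longrightarrow> P \<alpha> \<Longrightarrow> P (inc \<alpha> j)"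
  shows "P \<alpha>"
  using assms(1)
proof (induction "weight m (\<lambda>_. 1) \<alpha>" arbitrary: \<alpha>)
  case 0
  then have "\<alpha> = (\<lambda>_. 0)"
    by (auto simp: weight_def multi_index_def fun_eq_iff) (metis atMost_iff not_le)
  then show ?case using assms(2) by simp
next
  case (Suc n)
  then obtain j where j: "j \<le> m" "\<alpha> j > 0"
    by (auto simp: weight_def) (metis Suc_neq_Zero atMost_iff gr_zeroI sum.neutral)
  define \<beta> where "\<beta> = \<alpha>(j := \<alpha> j - 1)"
  have \<alpha>: "\<alpha> = inc \<beta> j" using j by (auto simp: \<beta>_def)
  have "\<beta> \<in> multi_index m" using Suc.prems by (auto simp: \<beta>_def multi_index_def)
  moreover have "n = weight m (\<lambda>_. 1) \<beta>" using Suc.hyps(2) j unfolding \<alpha> by (simp add: weight_inc)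
  ultimately show ?case using Suc.hyps(1) step j unfolding \<alpha> by blast
qed

lemma finite_weight_less:
  assumes "\<And>i. i \<le> m \<Longrightarrow> 0 < \<omega> i"
  shows "finite {\<alpha> \<in> multi_index m. weight m \<omega> \<alpha> < w}"
proof (rule finite_subset)
  show "finite {\<alpha>::nat\<Rightarrow>nat. \<forall>i. (i \<in> {..m} \<longrightarrow> \<alpha> i \<in> {..w}) \<and> (i \<notin> {..m} \<longrightarrow> \<alpha> i = 0)}"
    by (rule finite_set_of_finite_funs) auto
  have "\<alpha> i \<le> weight m \<omega> \<alpha>" if "i \<le> m" for \<alpha> i
  proof -
    have "\<alpha> i \<le> \<omega> i * \<alpha> i" using assms[OF that] by simp
    also have "\<dots> \<le> weight m \<omega> \<alpha>" unfolding weight_def using that by (intro member_le_sum) auto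
    finally show ?thesis .
  qed
  then show "{\<alpha> \<in> multi_index m. weight m \<omega> \<alpha> < w} \<subseteq>
      {\<alpha>::nat\<Rightarrow>nat. \<forall>i. (i \<in> {..m} \<longrightarrow> \<alpha> i \<in> {..w}) \<and> (i \<notin> {..m} \<longrightarrow> \<alpha> i = 0)}"
    by (auto simp: multi_index_def) (meson le_trans less_imp_le)
qed

text \<open>The shape is that of the polynomials in \<open>strongly_diff_transcendental\<close>,
  with a general family \<open>f\<close> in place of the successive derivatives.\<close>

definition algebraic_relation ::
  "'a::comm_ring_1 set \<Rightarrow> nat \<Rightarrow> (nat \<Rightarrow> 'a) \<Rightarrow> ((nat \<Rightarrow> nat) \<Rightarrow> 'a) \<Rightarrow> bool" where
  "algebraic_relation K m f c \<longleftrightarrow> (\<forall>\<alpha>. c \<alpha> \<in> K) \<and> finite {\<alpha>. c \<alpha> \<noteq> 0} \<and>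
     {\<alpha>. c \<alpha> \<noteq> 0} \<subseteq> multi_index m \<and> (\<exists>\<alpha>. c \<alpha> \<noteq> 0) \<and>
     (\<Sum>\<alpha> | c \<alpha> \<noteq> 0. c \<alpha> * monom_at m f \<alpha>) = 0"

lemma algebraic_relationI:
  assumes "finite B" "B \<subseteq> multi_index m" "\<And>\<alpha>. c \<alpha> \<in> K" "\<And>\<alpha>. \<alpha> \<notin> B \<Longrightarrow> c \<alpha> = 0" "c \<alpha> \<noteq> 0"
    "(\<Sum>\<alpha>\<in>B. c \<alpha> * monom_at m f \<alpha>) = 0"
  shows "algebraic_relation K m f c"
proof -
  have sub: "{\<alpha>. c \<alpha> \<noteq> 0} \<subseteq> B" using assms(4) by auto
  have "(\<Sum>\<alpha> | c \<alpha> \<noteq> 0. c \<alpha> * monom_at m f \<alpha>) = (\<Sum>\<alpha>\<in>B. c \<alpha> * monom_at m f \<alpha>)"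
    using sub assms(1) by (intro sum.mono_neutral_left) auto
  then show ?thesis using assms sub finite_subset unfolding algebraic_relation_def by auto
qed

lemma algebraic_relation_sum:
  assumes "algebraic_relation K m f c" "finite B" "{\<alpha>. c \<alpha> \<noteq> 0} \<subseteq> B"
  shows "(\<Sum>\<alpha>\<in>B. c \<alpha> * monom_at m f \<alpha>) = 0"
proof -
  have "(\<Sum>\<alpha>\<in>B. c \<alpha> * monom_at m f \<alpha>) = (\<Sum>\<alpha> | c \<alpha> \<noteq> 0. c \<alpha> * monom_at m f \<alpha>)"
    using assms by (intro sum.mono_neutral_right) auto
  then show ?thesis using assms by (simp add: algebraic_relation_def)
qed

text \<open>The subfield is a set inside a type because the meromorphic germs have to sit inside the
  field of all formal Laurent series, which also contains the divergent ones.\<close>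

locale subfield_set =
  fixes K :: "'a::field_char_0 set"
  assumes K_0: "0 \<in> K" and K_1: "1 \<in> K"
    and K_add: "x \<in> K \<Longrightarrow> y \<in> K \<Longrightarrow> x + y \<in> K"
    and K_mult: "x \<in> K \<Longrightarrow> y \<in> K \<Longrightarrow> x * y \<in> K"
    and K_minus: "x \<in> K \<Longrightarrow> - x \<in> K"
    and K_inverse: "x \<in> K \<Longrightarrow> inverse x \<in> K"
begin

lemma K_diff: "x \<in> K \<Longrightarrow> y \<in> K \<Longrightarrow> x - y \<in> K"
  using K_add[of x "- y"] K_minus by simp

lemma K_divide: "x \<in> K \<Longrightarrow> y \<in> K \<Longrightarrow> x / y \<in> K"
  by (simp add: divide_inverse K_mult K_inverse)

lemma K_of_nat: "of_nat n \<in> K"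
  by (induction n) (auto intro: K_0 K_1 K_add)

lemma K_sum: "(\<And>i. i \<in> A \<Longrightarrow> g i \<in> K) \<Longrightarrow> sum g A \<in> K"
  by (induction A rule: infinite_finite_induct) (auto intro: K_0 K_add)

lemma K_power: "x \<in> K \<Longrightarrow> x ^ n \<in> K"
  by (induction n) (auto intro: K_1 K_mult)

lemma K_prod: "(\<And>i. i \<in> A \<Longrightarrow> g i \<in> K) \<Longrightarrow> prod g A \<in> K"
  by (induction A rule: infinite_finite_induct) (auto intro: K_1 K_mult)

text \<open>The \<open>K\<close>-linear span of the monomials with exponents in \<open>S\<close>. It
  plays the part of an error term: only membership is tracked through products and sums, and
  \<open>monom_span_coeffs\<close> recovers actual coefficients at the end.\<close>

inductive_set monom_span :: "nat \<Rightarrow> (nat \<Rightarrow> 'a) \<Rightarrow> (nat \<Rightarrow> nat) set \<Rightarrow> 'a set"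
  for m f S where
  zero: "0 \<in> monom_span m f S"
| step: "k \<in> K \<Longrightarrow> \<alpha> \<in> S \<Longrightarrow> x \<in> monom_span m f S \<Longrightarrow> k * monom_at m f \<alpha> + x \<in> monom_span m f S"

lemma monom_span_mono: "x \<in> monom_span m f S \<Longrightarrow> S \<subseteq> T \<Longrightarrow> x \<in> monom_span m f T"
  by (induction rule: monom_span.induct) (auto intro: monom_span.intros)

lemma monom_span_base: "k \<in> K \<Longrightarrow> \<alpha> \<in> S \<Longrightarrow> k * monom_at m f \<alpha> \<in> monom_span m f S"
  using monom_span.step[OF _ _ monom_span.zero] by fastforce

lemma monom_span_add:
  "x \<in> monom_span m f S \<Longrightarrow> y \<in> monom_span m f S \<Longrightarrow> x + y \<in> monom_span m f S"
  by (induction rule: monom_span.induct) (auto intro: monom_span.intros simp: add.assoc)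

lemma monom_span_scale:
  assumes "k \<in> K" "x \<in> monom_span m f S"
  shows "k * x \<in> monom_span m f S"
  using assms(2)
proof (induction rule: monom_span.induct)
  case (step k' \<alpha> x)
  then show ?case
    using monom_span.step[OF K_mult[OF assms(1) step.hyps(1)] step.hyps(2) step.IH]
    by (simp add: algebra_simps)
qed (auto intro: monom_span.intros)

lemma monom_span_sum: "(\<And>i. i \<in> A \<Longrightarrow> g i \<in> monom_span m f S) \<Longrightarrow> sum g A \<in> monom_span m f S"
  by (induction A rule: infinite_finite_induct) (auto intro: monom_span.zero monom_span_add)

lemma monom_span_mult:
  assumes x: "x \<in> monom_span m f S" and y: "y \<in> monom_span m f T"
    and ST: "\<And>\<alpha> \<beta>. \<alpha> \<in> S \<Longrightarrow> \<beta> \<in> T \<Longrightarrow> (\<lambda>i. \<alpha> i + \<beta> i) \<in> U"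
  shows "x * y \<in> monom_span m f U"
proof -
  have *: "monom_at m f \<alpha> * y \<in> monom_span m f U" if "\<alpha> \<in> S" for \<alpha>
    using y
  proof (induction rule: monom_span.induct)
    case (step k \<beta> y)
    then show ?case
      using monom_span.step[OF step.hyps(1) ST[OF that step.hyps(2)] step.IH]
      by (simp add: algebra_simps monom_at_add)
  qed (auto intro: monom_span.intros)
  show ?thesis
    using x
  proof (induction rule: monom_span.induct)
    case (step k \<alpha> x)
    then show ?case
      using monom_span_add[OF monom_span_scale[OF step.hyps(1) *[OF step.hyps(2)]] step.IH]
      by (simp add: algebra_simps)
  qed (auto intro: monom_span.intros)
qed

lemma monom_span_coeffs:
  assumes "x \<in> monom_span m f S" "finite S"
  shows "\<exists>c. (\<forall>\<alpha>. c \<alpha> \<in> K) \<and> (\<forall>\<alpha>. \<alpha> \<notin> S \<longrightarrow> c \<alpha> = 0) \<and> x = (\<Sum>\<alpha>\<in>S. c \<alpha> * monom_at m f \<alpha>)"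
  using assms(1)
  proof (induction rule: monom_span.induct)
    case zero
    show ?case by (intro exI[of _ "\<lambda>_. 0"]) (auto intro: K_0)
  next
    case (step k \<alpha> x)
    then obtain c where c: "\<forall>\<alpha>. c \<alpha> \<in> K" "\<forall>\<alpha>. \<alpha> \<notin> S \<longrightarrow> c \<alpha> = 0" "x = (\<Sum>\<alpha>\<in>S. c \<alpha> * monom_at m f \<alpha>)"
      by blast
    show ?case
      using c step.hyps assms(2)
      by (intro exI[of _ "c(\<alpha> := c \<alpha> + k)"])
         (auto intro: K_add simp: sum.remove[of S \<alpha>] algebra_simps)
  qed

text \<open>Multiply out one factor \<open>k j * f j + l j\<close> at a time: taking
  \<open>l j\<close>, or a factor from the earlier remainder, strictly lowers the weight, so only
  the diagonal term keeps full weight.\<close>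

lemma monom_at_triangular:
  assumes \<alpha>: "\<alpha> \<in> multi_index m"
    and g: "\<And>i. i \<le> m \<Longrightarrow> g i = k i * f i + l i"
    and k: "\<And>i. i \<le> m \<Longrightarrow> k i \<in> K"
    and l: "\<And>i. i \<le> m \<Longrightarrow> l i \<in> monom_span m f {\<alpha> \<in> multi_index m. weight m \<omega> \<alpha> < \<omega> i}"
  shows "monom_at m g \<alpha> - monom_at m k \<alpha> * monom_at m f \<alpha>
           \<in> monom_span m f {\<beta> \<in> multi_index m. weight m \<omega> \<beta> < weight m \<omega> \<alpha>}"
  using \<alpha>
proof (induction rule: multi_index_induct)
  case zero
  then show ?case by (auto intro: monom_span.zero)
next
  case (inc \<alpha> j)
  let ?E = "\<lambda>w. {\<beta> \<in> multi_index m. weight m \<omega> \<beta> < w}"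
  define w where "w = weight m \<omega> \<alpha>"
  define r where "r = monom_at m g \<alpha> - monom_at m k \<alpha> * monom_at m f \<alpha>"
  have r: "r \<in> monom_span m f (?E w)" using inc.IH by (simp add: r_def w_def)
  have kK: "monom_at m k \<alpha> \<in> K" unfolding monom_at_def using k by (auto intro!: K_prod K_power)
  have "1 * monom_at m f \<alpha> \<in> monom_span m f {\<alpha>}" by (intro monom_span_base K_1) simp
  then have "monom_at m f \<alpha> * l j \<in> monom_span m f (?E (w + \<omega> j))"
    by (intro monom_span_mult[OF _ l[OF inc(2)], of _ "{\<alpha>}"])
       (use inc(1) in \<open>auto simp: multi_index_add weight_add w_def\<close>)
  then have 1: "monom_at m k \<alpha> * (monom_at m f \<alpha> * l j) \<in> monom_span m f (?E (w + \<omega> j))"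
    by (rule monom_span_scale[OF kK])
  have 2: "r * l j \<in> monom_span m f (?E (w + \<omega> j))"
    by (rule monom_span_mult[OF r l[OF inc(2)]]) (auto simp: multi_index_add weight_add)
  define e :: "nat \<Rightarrow> nat" where "e = inc (\<lambda>_. 0) j"
  have e: "e \<in> multi_index m" "weight m \<omega> e = \<omega> j" "monom_at m f e = f j"
    using inc(2) weight_inc[of j m \<omega> "\<lambda>_. 0"] monom_at_inc[of j m f "\<lambda>_. 0"]
    by (auto simp: e_def multi_index_def weight_def)
  have "1 * monom_at m f e \<in> monom_span m f {e}" by (intro monom_span_base K_1) simp
  then have "r * f j \<in> monom_span m f (?E (w + \<omega> j))"
    by (intro monom_span_mult[OF r, of _ "{e}"]) (use e in \<open>auto simp: multi_index_add weight_add\<close>)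
  then have 3: "k j * (r * f j) \<in> monom_span m f (?E (w + \<omega> j))"
    by (rule monom_span_scale[OF k[OF inc(2)]])
  have "monom_at m g (inc \<alpha> j) - monom_at m k (inc \<alpha> j) * monom_at m f (inc \<alpha> j) =
      (r + monom_at m k \<alpha> * monom_at m f \<alpha>) * (k j * f j + l j)
      - monom_at m k \<alpha> * k j * (monom_at m f \<alpha> * f j)"
    using inc(2) by (simp add: monom_at_inc g r_def)
  also have "\<dots> = monom_at m k \<alpha> * (monom_at m f \<alpha> * l j) + (r * l j + k j * (r * f j))"
    by (simp add: algebra_simps)
  also have "\<dots> \<in> monom_span m f (?E (w + \<omega> j))"
    by (intro monom_span_add 1 2 3)
  finally show ?case using inc(2) by (simp only: weight_inc w_def)
qed

text \<open>On monomials of maximal weight the substitution acts diagonally, so the transformed relation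
  stays nontrivial.\<close>

lemma algebraic_relation_triangular:
  assumes rel: "algebraic_relation K m g c"
    and \<omega>: "\<And>i. i \<le> m \<Longrightarrow> 0 < \<omega> i"
    and g: "\<And>i. i \<le> m \<Longrightarrow> g i = k i * f i + l i"
    and k: "\<And>i. i \<le> m \<Longrightarrow> k i \<in> K" "\<And>i. i \<le> m \<Longrightarrow> k i \<noteq> 0"
    and l: "\<And>i. i \<le> m \<Longrightarrow> l i \<in> monom_span m f {\<alpha> \<in> multi_index m. weight m \<omega> \<alpha> < \<omega> i}"
  shows "\<exists>d. algebraic_relation K m f d"
proof -
  let ?E = "\<lambda>w. {\<beta> \<in> multi_index m. weight m \<omega> \<beta> < w}"
  define A where "A = {\<alpha>. c \<alpha> \<noteq> 0}"
  have A: "finite A" "A \<noteq> {}" "A \<subseteq> multi_index m" and cK: "\<And>\<alpha>. c \<alpha> \<in> K"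
    and A0: "(\<Sum>\<alpha>\<in>A. c \<alpha> * monom_at m g \<alpha>) = 0"
    using rel by (auto simp: algebraic_relation_def A_def)
  define W where "W = Max (weight m \<omega> ` A)"
  obtain \<alpha>0 where \<alpha>0: "\<alpha>0 \<in> A" "weight m \<omega> \<alpha>0 = W"
    using Max_in[of "weight m \<omega> ` A"] A unfolding W_def by (metis finite_imageI image_iff image_is_empty)
  have W: "weight m \<omega> \<alpha> \<le> W" if "\<alpha> \<in> A" for \<alpha> using that A by (auto simp: W_def)
  have kK: "monom_at m k \<alpha> \<in> K" for \<alpha> unfolding monom_at_def using k by (auto intro!: K_prod K_power)
  define r where "r \<alpha> = monom_at m g \<alpha> - monom_at m k \<alpha> * monom_at m f \<alpha>" for \<alpha>
  have r: "r \<alpha> \<in> monom_span m f (?E W)" if "\<alpha> \<in> A" for \<alpha>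
    unfolding r_def
    by (rule monom_span_mono[OF monom_at_triangular[where \<omega> = \<omega> and l = l]])
       (use A that g k l W[OF that] in auto)
  define R where "R = (\<Sum>\<alpha>\<in>A. c \<alpha> * r \<alpha>)"
  have R: "R \<in> monom_span m f (?E W)"
    unfolding R_def by (intro monom_span_sum monom_span_scale cK r)
  obtain \<rho> where \<rho>: "\<And>\<alpha>. \<rho> \<alpha> \<in> K" "\<And>\<alpha>. \<alpha> \<notin> ?E W \<Longrightarrow> \<rho> \<alpha> = 0"
      "R = (\<Sum>\<alpha>\<in>?E W. \<rho> \<alpha> * monom_at m f \<alpha>)"
    using monom_span_coeffs[OF R] finite_weight_less[of m \<omega> W] \<omega> by blast
  define d where "d \<alpha> = c \<alpha> * monom_at m k \<alpha> + \<rho> \<alpha>" for \<alpha>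
  let ?B = "?E (Suc W)"
  have fB: "finite ?B" using finite_weight_less[of m \<omega>] \<omega> by blast
  have AB: "A \<subseteq> ?B" using A W by (auto simp: less_Suc_eq_le)
  have "(\<Sum>\<alpha>\<in>?B. d \<alpha> * monom_at m f \<alpha>)
      = (\<Sum>\<alpha>\<in>?B. c \<alpha> * monom_at m k \<alpha> * monom_at m f \<alpha>) + (\<Sum>\<alpha>\<in>?B. \<rho> \<alpha> * monom_at m f \<alpha>)"
    by (simp add: d_def sum.distrib algebra_simps)
  also have "(\<Sum>\<alpha>\<in>?B. c \<alpha> * monom_at m k \<alpha> * monom_at m f \<alpha>) = (\<Sum>\<alpha>\<in>A. c \<alpha> * monom_at m k \<alpha> * monom_at m f \<alpha>)"
    using AB fB by (intro sum.mono_neutral_right) (auto simp: A_def)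
  also have "(\<Sum>\<alpha>\<in>?B. \<rho> \<alpha> * monom_at m f \<alpha>) = (\<Sum>\<alpha>\<in>?E W. \<rho> \<alpha> * monom_at m f \<alpha>)"
    using fB \<rho>(2) by (intro sum.mono_neutral_right) auto
  also have "(\<Sum>\<alpha>\<in>A. c \<alpha> * monom_at m k \<alpha> * monom_at m f \<alpha>) + \<dots> = (\<Sum>\<alpha>\<in>A. c \<alpha> * monom_at m g \<alpha>)"
    unfolding \<rho>(3)[symmetric] R_def sum.distrib[symmetric]
    by (intro sum.cong) (auto simp: r_def algebra_simps)
  finally have "(\<Sum>\<alpha>\<in>?B. d \<alpha> * monom_at m f \<alpha>) = 0" using A0 by simp
  \<comment> \<open>\<open>\<alpha>0\<close> has the maximal weight \<open>W\<close> while
    \<open>\<rho>\<close> lives in weight below \<open>W\<close>, so nothing can cancel the diagonal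
    term.\<close>
  moreover have "d \<alpha>0 \<noteq> 0"
    using \<alpha>0 \<rho>(2)[of \<alpha>0] k by (auto simp: d_def A_def monom_at_def)
  moreover have "d \<alpha> \<in> K" for \<alpha> unfolding d_def by (intro K_add K_mult cK kK \<rho>)
  moreover have "d \<alpha> = 0" if "\<alpha> \<notin> ?B" for \<alpha>
  proof -
    have "\<alpha> \<notin> ?E W" using that by auto
    then show ?thesis using that AB \<rho>(2) by (auto simp: d_def A_def)
  qed
  ultimately show ?thesis
    using algebraic_relationI[OF fB, of m d K \<alpha>0 f] by blast
qed


end

subsection \<open>Ostrowski's argument\<close>

text \<open>Instantiated by the shift u -> u/(1-u), and once more by the substitution x = -u^2,
  there for the homomorphism laws.\<close>

locale difference_subfield = subfield_set +
  fixes \<tau> :: "'a \<Rightarrow> 'a"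
  assumes \<tau>_add: "\<tau> (x + y) = \<tau> x + \<tau> y" and \<tau>_mult: "\<tau> (x * y) = \<tau> x * \<tau> y"
    and \<tau>_1: "\<tau> 1 = 1" and \<tau>_K: "x \<in> K \<Longrightarrow> \<tau> x \<in> K"
begin

lemma \<tau>_0: "\<tau> 0 = 0"
  using \<tau>_add[of 0 0] by simp

lemma \<tau>_sum: "\<tau> (sum g A) = (\<Sum>i\<in>A. \<tau> (g i))"
  by (induction A rule: infinite_finite_induct) (auto simp: \<tau>_0 \<tau>_add)

text \<open>First-order Taylor expansion in the increments \<open>b\<close>: a term with two or more
  factors \<open>b i\<close> has lost at least two degrees. The truncated subtraction is right for
  degree 0 and 1, where the span is that of the empty set and the expansion is exact.\<close>

lemma \<tau>_monom_at:
  assumes \<alpha>: "\<alpha> \<in> multi_index m"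
    and f: "\<And>i. i \<le> m \<Longrightarrow> \<tau> (f i) = f i + b i"
    and b: "\<And>i. i \<le> m \<Longrightarrow> b i \<in> K"
  shows "\<tau> (monom_at m f \<alpha>) - monom_at m f \<alpha>
           - (\<Sum>i\<le>m. of_nat (\<alpha> i) * b i * monom_at m f (\<alpha>(i := \<alpha> i - 1)))
         \<in> monom_span m f {\<beta> \<in> multi_index m. weight m (\<lambda>_. 1) \<beta> < weight m (\<lambda>_. 1) \<alpha> - 1}"
  using \<alpha>
proof (induction rule: multi_index_induct)
  case zero
  show ?case by (simp add: \<tau>_1 monom_span.zero)
next
  case (inc \<alpha> j)
  let ?E = "\<lambda>w. {\<beta> \<in> multi_index m. weight m (\<lambda>_. 1) \<beta> < w}"
  define w where "w = weight m (\<lambda>_. 1) \<alpha>"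
  define D where "D \<alpha> = (\<Sum>i\<le>m. of_nat (\<alpha> i) * b i * monom_at m f (\<alpha>(i := \<alpha> i - 1)))" for \<alpha>
  define r where "r = \<tau> (monom_at m f \<alpha>) - monom_at m f \<alpha> - D \<alpha>"
  have r: "r \<in> monom_span m f (?E (w - 1))" using inc.IH unfolding r_def w_def D_def .
  \<comment> \<open>Leibniz rule for the formal derivation sending \<open>f i\<close> to
    \<open>b i\<close>. Where \<open>\<alpha> i = 0\<close>, the meaningless exponent
    \<open>\<alpha> i - 1\<close> is masked by the factor
    \<open>of_nat (\<alpha> i)\<close>.\<close>
  have D_inc: "D (inc \<alpha> j) = D \<alpha> * f j + b j * monom_at m f \<alpha>"
  proof -
    have *: "of_nat (inc \<alpha> j i) * b i * monom_at m f ((inc \<alpha> j)(i := inc \<alpha> j i - 1))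
        = of_nat (\<alpha> i) * b i * monom_at m f (\<alpha>(i := \<alpha> i - 1)) * f j
          + (if i = j then b j * monom_at m f \<alpha> else 0)" if "i \<le> m" for i
    proof (cases "i = j")
      case False
      then have "(inc \<alpha> j)(i := inc \<alpha> j i - 1) = inc (\<alpha>(i := \<alpha> i - 1)) j" by auto
      then show ?thesis using False monom_at_inc[OF inc(2), of f "\<alpha>(i := \<alpha> i - 1)"] by simp
    next
      case True
      have "of_nat (\<alpha> j) * monom_at m f \<alpha> = of_nat (\<alpha> j) * (monom_at m f (\<alpha>(j := \<alpha> j - 1)) * f j)"
      proof (cases "\<alpha> j = 0")
        case False
        then have "inc (\<alpha>(j := \<alpha> j - 1)) j = \<alpha>" by auto
        then show ?thesis using monom_at_inc[OF inc(2), of f "\<alpha>(j := \<alpha> j - 1)"] by simp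
      qed simp
      then show ?thesis using True by (simp add: algebra_simps)
    qed
    have "D (inc \<alpha> j) = (\<Sum>i\<le>m. of_nat (\<alpha> i) * b i * monom_at m f (\<alpha>(i := \<alpha> i - 1)) * f j
          + (if i = j then b j * monom_at m f \<alpha> else 0))"
      unfolding D_def by (intro sum.cong refl *) simp
    then show ?thesis using inc(2) by (simp add: D_def sum.distrib sum_distrib_right)
  qed
  have "D \<alpha> \<in> monom_span m f (?E w)"
    unfolding D_def
  proof (rule monom_span_sum)
    fix i assume "i \<in> {..m}"
    then have i: "i \<le> m" by simp
    show "of_nat (\<alpha> i) * b i * monom_at m f (\<alpha>(i := \<alpha> i - 1)) \<in> monom_span m f (?E w)"
    proof (cases "\<alpha> i = 0")
      case True
      then show ?thesis by (simp add: monom_span.zero)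
    next
      case False
      define \<beta> where "\<beta> = \<alpha>(i := \<alpha> i - 1)"
      have "\<alpha> = inc \<beta> i" using False by (auto simp: \<beta>_def)
      then have "weight m (\<lambda>_. 1) \<beta> < w" using weight_inc[OF i, of "\<lambda>_. 1" \<beta>] by (simp add: w_def)
      moreover have "\<beta> \<in> multi_index m" using inc(1) by (auto simp: \<beta>_def multi_index_def)
      ultimately have "of_nat (\<alpha> i) * b i * monom_at m f \<beta> \<in> monom_span m f (?E w)"
        by (intro monom_span_base K_mult K_of_nat b i) auto
      then show ?thesis by (simp add: \<beta>_def)
    qed
  qed
  then have 1: "b j * D \<alpha> \<in> monom_span m f (?E w)" by (rule monom_span_scale[OF b[OF inc(2)]])
  have 2: "b j * r \<in> monom_span m f (?E w)"
    by (intro monom_span_scale b inc(2) monom_span_mono[OF r]) auto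
  define e :: "nat \<Rightarrow> nat" where "e = inc (\<lambda>_. 0) j"
  have e: "e \<in> multi_index m" "weight m (\<lambda>_. 1) e = 1" "monom_at m f e = f j"
    using inc(2) weight_inc[of j m "\<lambda>_. 1" "\<lambda>_. 0"] monom_at_inc[of j m f "\<lambda>_. 0"]
    by (auto simp: e_def multi_index_def weight_def)
  have "1 * monom_at m f e \<in> monom_span m f {e}" by (intro monom_span_base K_1) simp
  then have 3: "r * f j \<in> monom_span m f (?E w)"
    by (intro monom_span_mult[OF r, of _ "{e}"]) (use e in \<open>auto simp: multi_index_add weight_add\<close>)
  have "\<tau> (monom_at m f (inc \<alpha> j)) - monom_at m f (inc \<alpha> j) - D (inc \<alpha> j)
      = (r + monom_at m f \<alpha> + D \<alpha>) * (f j + b j) - monom_at m f \<alpha> * f j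
        - (D \<alpha> * f j + b j * monom_at m f \<alpha>)"
    using inc(2) by (simp add: monom_at_inc \<tau>_mult f r_def D_inc)
  also have "\<dots> = b j * D \<alpha> + (b j * r + r * f j)" by (simp add: algebra_simps)
  also have "\<dots> \<in> monom_span m f (?E w)" by (intro monom_span_add 1 2 3)
  finally show ?case
    using inc(2) by (simp only: D_def weight_inc w_def add_diff_cancel_right')
qed

text \<open>Take a relation of minimal degree, with one top coefficient equal to $1$ and as few top terms
  as possible. Applying \<open>\<tau>\<close> and subtracting gives a smaller relation, which must be trivial: the top
  coefficients are \<open>\<tau>\<close>-invariant, and the coefficient of a monomial one degree lower gives the
  linear relation.\<close>

lemma linear_relation_of_algebraic_relation:
  assumes rel: "algebraic_relation K m f c0"
    and f: "\<And>i. i \<le> m \<Longrightarrow> \<tau> (f i) = f i + b i"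
    and b: "\<And>i. i \<le> m \<Longrightarrow> b i \<in> K"
  shows "\<exists>a g. (\<forall>i\<le>m. a i \<in> K \<and> \<tau> (a i) = a i) \<and> (\<exists>i\<le>m. a i \<noteq> 0) \<and> g \<in> K \<and>
           (\<Sum>i\<le>m. a i * b i) = \<tau> g - g"
proof -
  let ?deg = "weight m (\<lambda>_. 1)"
  define P where "P d c \<longleftrightarrow> algebraic_relation K m f c \<and> (\<forall>\<alpha>. c \<alpha> \<noteq> 0 \<longrightarrow> ?deg \<alpha> \<le> d)" for d c
  have "P (Max (?deg ` {\<alpha>. c0 \<alpha> \<noteq> 0})) c0"
    using rel by (auto simp: P_def algebraic_relation_def)
  then obtain d where d: "\<exists>c. P d c" "\<And>d' c. P d' c \<Longrightarrow> d \<le> d'"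
    using exists_least_iff[of "\<lambda>d. \<exists>c. P d c"] by (metis not_le)
  define N where "N c = card {\<alpha>. c \<alpha> \<noteq> 0 \<and> ?deg \<alpha> = d}" for c :: "(nat \<Rightarrow> nat) \<Rightarrow> 'a"
  obtain c1 where c1: "P d c1" "\<And>c. P d c \<Longrightarrow> N c1 \<le> N c"
    using d(1) ex_has_least_nat[of "P d" _ N] by metis
  have fin1: "finite {\<alpha>. c1 \<alpha> \<noteq> 0}" and sub1: "{\<alpha>. c1 \<alpha> \<noteq> 0} \<subseteq> multi_index m"
    and K1: "\<And>\<alpha>. c1 \<alpha> \<in> K"
    using c1(1) by (auto simp: P_def algebraic_relation_def)
  obtain \<alpha>0 where \<alpha>0: "c1 \<alpha>0 \<noteq> 0" "?deg \<alpha>0 = d"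
  proof (cases "\<exists>\<alpha>. c1 \<alpha> \<noteq> 0 \<and> ?deg \<alpha> = d")
    case False
    obtain \<alpha> where \<alpha>: "c1 \<alpha> \<noteq> 0" using c1(1) by (auto simp: P_def algebraic_relation_def)
    have lt: "?deg \<beta> < d" if "c1 \<beta> \<noteq> 0" for \<beta>
      using False c1(1) that by (metis P_def le_neq_implies_less)
    have "d > 0" using lt[OF \<alpha>] by simp
    have "P (d - 1) c1" using lt c1(1) \<open>d > 0\<close> by (fastforce simp: P_def)
    then show ?thesis using d(2) \<open>d > 0\<close> by fastforce
  qed (use that in blast)
  have \<alpha>0m: "\<alpha>0 \<in> multi_index m" using \<alpha>0 sub1 by blast
  define c where "c \<alpha> = c1 \<alpha> / c1 \<alpha>0" for \<alpha>
  have c_iff: "c \<alpha> \<noteq> 0 \<longleftrightarrow> c1 \<alpha> \<noteq> 0" for \<alpha> using \<alpha>0 by (simp add: c_def)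
  have cK: "c \<alpha> \<in> K" for \<alpha> unfolding c_def by (intro K_divide K1)
  have c\<alpha>0: "c \<alpha>0 = 1" using \<alpha>0 by (simp add: c_def)
  define E where "E w = {\<beta> \<in> multi_index m. ?deg \<beta> < w}" for w
  have finE: "finite (E w)" for w unfolding E_def by (intro finite_weight_less) auto
  define B where "B = E (Suc d)"
  have supp: "{\<alpha>. c \<alpha> \<noteq> 0} \<subseteq> B"
    using c1(1) sub1 by (auto simp: B_def E_def P_def c_iff less_Suc_eq_le)
  have "(\<Sum>\<alpha>\<in>B. c1 \<alpha> * monom_at m f \<alpha>) = 0"
    using c1(1) finE supp
    by (intro algebraic_relation_sum[where K = K]) (auto simp: B_def P_def c_iff)
  then have c_sum: "(\<Sum>\<alpha>\<in>B. c \<alpha> * monom_at m f \<alpha>) = 0"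
    by (simp add: c_def sum_divide_distrib[symmetric])

  define T where "T = {\<alpha> \<in> multi_index m. ?deg \<alpha> = d}"
  define L where "L = E d"
  have fB: "finite B" unfolding B_def by (rule finE)
  have BTL: "B = T \<union> L" "T \<inter> L = {}" by (auto simp: B_def T_def L_def E_def)
  then have B: "finite T" "finite L" using fB by auto
  define D where "D \<alpha> = (\<Sum>i\<le>m. of_nat (\<alpha> i) * b i * monom_at m f (\<alpha>(i := \<alpha> i - 1)))" for \<alpha>
  define r where "r \<alpha> = \<tau> (monom_at m f \<alpha>) - monom_at m f \<alpha> - D \<alpha>" for \<alpha>
  have r: "r \<alpha> \<in> monom_span m f (E (?deg \<alpha> - 1))" if "\<alpha> \<in> B" for \<alpha>
    using \<tau>_monom_at[of \<alpha> m f b] that f b by (auto simp: r_def D_def E_def B_def)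
  have dec: "\<alpha>(i := \<alpha> i - 1) \<in> multi_index m" "?deg \<alpha> = Suc (?deg (\<alpha>(i := \<alpha> i - 1)))"
    if "\<alpha> \<in> multi_index m" "i \<le> m" "\<alpha> i \<noteq> 0" for \<alpha> i
  proof -
    have "\<alpha> = inc (\<alpha>(i := \<alpha> i - 1)) i" using that by auto
    then show "?deg \<alpha> = Suc (?deg (\<alpha>(i := \<alpha> i - 1)))"
      using weight_inc[OF that(2), of "\<lambda>_. 1" "\<alpha>(i := \<alpha> i - 1)"] by simp
  qed (use that in \<open>auto simp: multi_index_def\<close>)
  have D: "D \<alpha> \<in> monom_span m f (E (?deg \<alpha>))" if "\<alpha> \<in> B" for \<alpha>
    unfolding D_def
  proof (intro monom_span_sum)
    fix i assume "i \<in> {..m}"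
    then show "of_nat (\<alpha> i) * b i * monom_at m f (\<alpha>(i := \<alpha> i - 1)) \<in> monom_span m f (E (?deg \<alpha>))"
      using dec[of \<alpha> i] that
      by (cases "\<alpha> i = 0") (auto simp: E_def B_def intro!: monom_span.zero monom_span_base K_mult K_of_nat b)
  qed
  \<comment> \<open>Everything that falls below degree \<open>d - 1\<close>: the Taylor remainders
    of all monomials and the first-order terms of those that are not of top degree.\<close>
  define R where "R = (\<Sum>\<alpha>\<in>B. \<tau> (c \<alpha>) * r \<alpha>) + (\<Sum>\<alpha>\<in>L. \<tau> (c \<alpha>) * D \<alpha>)"
  have R: "R \<in> monom_span m f (E (d - 1))"
    unfolding R_def
    by (intro monom_span_add monom_span_sum monom_span_scale \<tau>_K cK monom_span_mono[OF r] monom_span_mono[OF D])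
       (auto simp: B_def L_def E_def)
  obtain \<rho> where \<rho>: "\<And>\<alpha>. \<rho> \<alpha> \<in> K" "\<And>\<alpha>. \<alpha> \<notin> E (d - 1) \<Longrightarrow> \<rho> \<alpha> = 0"
      "R = (\<Sum>\<alpha>\<in>E (d - 1). \<rho> \<alpha> * monom_at m f \<alpha>)"
    using monom_span_coeffs[OF R finE] by blast
  define U where "U = {\<beta> \<in> multi_index m. Suc (?deg \<beta>) = d}"
  \<comment> \<open>The first-order terms of the top monomials, sorted by the monomial they produce:
    a pair \<open>(\<alpha>, i)\<close> with \<open>\<alpha> i > 0\<close> becomes
    \<open>(\<beta>, i)\<close>, where \<open>\<beta>\<close> is \<open>\<alpha>\<close> lowered at
    \<open>i\<close> and \<open>\<alpha> i = Suc (\<beta> i)\<close>.\<close>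
  define q where "q \<beta> = (if \<beta> \<in> U then \<Sum>i\<le>m. of_nat (Suc (\<beta> i)) * \<tau> (c (inc \<beta> i)) * b i else 0)" for \<beta>
  have qK: "q \<beta> \<in> K" for \<beta>
    unfolding q_def by (auto intro!: K_sum K_mult K_of_nat \<tau>_K cK b K_0 simp del: of_nat_Suc)
  have UL: "U \<subseteq> L" by (auto simp: U_def L_def E_def)
  then have fU: "finite U" using B(2) finite_subset by blast
  have top: "(\<Sum>\<alpha>\<in>T. \<tau> (c \<alpha>) * D \<alpha>) = (\<Sum>\<beta>\<in>U. q \<beta> * monom_at m f \<beta>)"
  proof -
    let ?t = "\<lambda>(\<alpha>, i). \<tau> (c \<alpha>) * (of_nat (\<alpha> i) * b i * monom_at m f (\<alpha>(i := \<alpha> i - 1)))"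
    let ?S = "{(\<alpha>, i). \<alpha> \<in> T \<and> i \<le> m \<and> \<alpha> i \<noteq> 0}"
    have "(\<Sum>\<alpha>\<in>T. \<tau> (c \<alpha>) * D \<alpha>) = (\<Sum>p\<in>T \<times> {..m}. ?t p)"
      by (simp add: D_def sum_distrib_left sum.cartesian_product)
    also have "\<dots> = (\<Sum>p\<in>?S. ?t p)"
      using B(1) by (intro sum.mono_neutral_right) auto
    also have "\<dots> = (\<Sum>p\<in>U \<times> {..m}. ?t (inc (fst p) (snd p), snd p))"
    proof (intro sum.reindex_bij_witness[of _ "\<lambda>(\<beta>, i). (inc \<beta> i, i)" "\<lambda>(\<alpha>, i). (\<alpha>(i := \<alpha> i - 1), i)"])
      fix p assume "p \<in> ?S"
      then show "(\<lambda>(\<alpha>, i). (\<alpha>(i := \<alpha> i - 1), i)) p \<in> U \<times> {..m}"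
        using dec by (auto simp: T_def U_def)
    qed (auto simp: T_def U_def weight_inc multi_index_inc)
    also have "\<dots> = (\<Sum>\<beta>\<in>U. \<Sum>i\<le>m. of_nat (Suc (\<beta> i)) * \<tau> (c (inc \<beta> i)) * b i * monom_at m f \<beta>)"
      by (subst sum.cartesian_product) (intro sum.cong, auto simp: algebra_simps)
    also have "\<dots> = (\<Sum>\<beta>\<in>U. q \<beta> * monom_at m f \<beta>)"
      by (intro sum.cong) (auto simp: q_def sum_distrib_right)
    finally show ?thesis .
  qed
  \<comment> \<open>Coefficients of the transformed relation minus the original one. In degree
    \<open>d\<close> only \<open>\<tau> (c \<beta>) - c \<beta>\<close> survives, and it vanishes at
    \<open>\<alpha>0\<close> since \<open>c \<alpha>0 = 1\<close>.\<close>
  define c' where "c' \<beta> = \<tau> (c \<beta>) - c \<beta> + q \<beta> + \<rho> \<beta>" for \<beta>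
  have EB: "E (d - 1) \<subseteq> B" "U \<subseteq> B" using UL BTL by (auto simp: B_def E_def)
  have c'_sum: "(\<Sum>\<beta>\<in>B. c' \<beta> * monom_at m f \<beta>) = 0"
  proof -
    have "0 = \<tau> (\<Sum>\<alpha>\<in>B. c \<alpha> * monom_at m f \<alpha>)" by (simp add: c_sum \<tau>_0)
    also have "\<dots> = (\<Sum>\<alpha>\<in>B. \<tau> (c \<alpha>) * monom_at m f \<alpha> + (\<tau> (c \<alpha>) * r \<alpha> + \<tau> (c \<alpha>) * D \<alpha>))"
      unfolding \<tau>_sum by (intro sum.cong) (auto simp: r_def \<tau>_mult algebra_simps)
    also have "\<dots> = (\<Sum>\<alpha>\<in>B. \<tau> (c \<alpha>) * monom_at m f \<alpha>) + (R + (\<Sum>\<alpha>\<in>T. \<tau> (c \<alpha>) * D \<alpha>))"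
      unfolding R_def sum.distrib BTL(1) using B BTL(2) by (simp add: sum.union_disjoint)
    also have "R = (\<Sum>\<beta>\<in>B. \<rho> \<beta> * monom_at m f \<beta>)"
      unfolding \<rho>(3) using EB \<rho>(2) fB by (intro sum.mono_neutral_left) auto
    also have "(\<Sum>\<alpha>\<in>T. \<tau> (c \<alpha>) * D \<alpha>) = (\<Sum>\<beta>\<in>B. q \<beta> * monom_at m f \<beta>)"
      unfolding top using EB fB by (intro sum.mono_neutral_left) (auto simp: q_def)
    finally have "0 = (\<Sum>\<beta>\<in>B. \<tau> (c \<beta>) * monom_at m f \<beta>) + ((\<Sum>\<beta>\<in>B. \<rho> \<beta> * monom_at m f \<beta>)
        + (\<Sum>\<beta>\<in>B. q \<beta> * monom_at m f \<beta>)) - (\<Sum>\<beta>\<in>B. c \<beta> * monom_at m f \<beta>)"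
      by (simp add: c_sum)
    also have "\<dots> = (\<Sum>\<beta>\<in>B. c' \<beta> * monom_at m f \<beta>)"
      by (simp add: c'_def sum.distrib sum_subtractf algebra_simps)
    finally show ?thesis by simp
  qed
  have c'K: "c' \<beta> \<in> K" for \<beta>
    unfolding c'_def by (intro K_add K_diff \<tau>_K cK qK \<rho>)
  have c'_out: "c' \<beta> = 0" if "\<beta> \<notin> B" for \<beta>
  proof -
    have "\<beta> \<notin> U" "\<beta> \<notin> E (d - 1)" "c \<beta> = 0" using that EB supp by auto
    then show ?thesis using \<rho>(2) by (simp add: c'_def q_def \<tau>_0)
  qed
  have c'_top: "c' \<beta> = \<tau> (c \<beta>) - c \<beta>" if "?deg \<beta> = d" for \<beta>
  proof -
    have "\<beta> \<notin> E (d - 1)" "\<beta> \<notin> U" using that by (auto simp: U_def E_def)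
    then show ?thesis using \<rho>(2) by (simp add: c'_def q_def)
  qed
  have c'_0: "c' \<beta> = 0" for \<beta>
  proof (rule ccontr)
    assume "c' \<beta> \<noteq> 0"
    then have "algebraic_relation K m f c'"
      by (intro algebraic_relationI[OF fB _ c'K c'_out _ c'_sum]) (auto simp: B_def E_def)
    moreover have "?deg \<alpha> \<le> d" if "c' \<alpha> \<noteq> 0" for \<alpha>
    proof -
      have "\<alpha> \<in> B" using that c'_out by blast
      then show ?thesis by (simp add: B_def E_def)
    qed
    ultimately have "N c1 \<le> N c'" by (intro c1(2)) (auto simp: P_def)
    moreover have "N c' < N c1"
      unfolding N_def
    proof (rule psubset_card_mono)
      show "finite {\<alpha>. c1 \<alpha> \<noteq> 0 \<and> ?deg \<alpha> = d}" using fin1 by (rule rev_finite_subset) auto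
      have "c' \<alpha>0 = 0" unfolding c'_top[OF \<alpha>0(2)] c\<alpha>0 \<tau>_1 by simp
      moreover have "c1 \<alpha> \<noteq> 0" if "c' \<alpha> \<noteq> 0" "?deg \<alpha> = d" for \<alpha>
        using c'_top[OF that(2)] that(1) c_iff[of \<alpha>] \<tau>_0 by force
      ultimately show "{\<alpha>. c' \<alpha> \<noteq> 0 \<and> ?deg \<alpha> = d} \<subset> {\<alpha>. c1 \<alpha> \<noteq> 0 \<and> ?deg \<alpha> = d}"
        using \<alpha>0 by blast
    qed
    ultimately show False by simp
  qed
  have "d \<noteq> 0"
  proof
    assume "d = 0"
    have B0: "B = {\<lambda>_. 0}"
    proof -
      have "\<alpha> = (\<lambda>_. 0)" if "\<alpha> \<in> B" for \<alpha>
        using that \<open>d = 0\<close>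
        by (auto simp: B_def E_def weight_def multi_index_def fun_eq_iff) (metis atMost_iff not_le)
      moreover have "\<alpha>0 \<in> B" using supp c\<alpha>0 by auto
      ultimately show ?thesis by blast
    qed
    have "\<alpha>0 \<in> B" using supp c\<alpha>0 by (metis (mono_tags) mem_Collect_eq subsetD zero_neq_one)
    then have "\<alpha>0 = (\<lambda>_. 0)" using B0 by blast
    moreover have "c (\<lambda>_. 0) = 0" using c_sum by (simp add: B0)
    ultimately show False using c\<alpha>0 by (metis zero_neq_one)
  qed
  obtain i0 where i0: "i0 \<le> m" "\<alpha>0 i0 \<noteq> 0"
  proof -
    have "(\<Sum>i\<le>m. \<alpha>0 i) \<noteq> 0" using \<alpha>0 \<open>d \<noteq> 0\<close> by (simp add: weight_def)
    then show ?thesis using that by (metis atMost_iff sum.neutral)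
  qed
  define \<beta> where "\<beta> = \<alpha>0(i0 := \<alpha>0 i0 - 1)"
  have \<beta>: "\<beta> \<in> U" using dec[OF \<alpha>0m i0] \<alpha>0 by (auto simp: \<beta>_def U_def)
  have inc\<beta>: "inc \<beta> i0 = \<alpha>0" using i0 by (auto simp: \<beta>_def)
  \<comment> \<open>Vanishing of \<open>c'\<close> at \<open>\<beta>\<close>, where
    \<open>\<rho>\<close> is zero, equates the sum of the
    \<open>(\<beta> i + 1) * c (inc \<beta> i) * b i\<close> with
    \<open>- (\<tau> (c \<beta>) - c \<beta>)\<close>; hence the sign. At \<open>i0\<close> the
    value is minus the positive integer \<open>\<alpha>0 i0\<close>, nonzero in characteristic
    0.\<close>
  define a where "a i = - (of_nat (Suc (\<beta> i)) * c (inc \<beta> i))" for i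
  have \<tau>c: "\<tau> (c (inc \<beta> i)) = c (inc \<beta> i)" if "i \<le> m" for i
  proof -
    have "?deg (inc \<beta> i) = d" using \<beta> that by (auto simp: U_def weight_inc)
    then show ?thesis using c'_top c'_0 by (metis eq_iff_diff_eq_0)
  qed
  have \<tau>n: "\<tau> (of_nat n) = of_nat n" for n by (induction n) (auto simp: \<tau>_0 \<tau>_1 \<tau>_add)
  have \<tau>neg: "\<tau> (- x) = - \<tau> x" for x
    using \<tau>_add[of x "- x"] by (simp add: \<tau>_0 add_eq_0_iff)
  have "\<rho> \<beta> = 0" using \<beta> by (intro \<rho>(2)) (auto simp: U_def E_def)
  then have "0 = \<tau> (c \<beta>) - c \<beta> + q \<beta>" using c'_0[of \<beta>] by (simp add: c'_def)
  moreover have "q \<beta> = - (\<Sum>i\<le>m. a i * b i)"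
    using \<beta> \<tau>c by (simp add: q_def a_def sum_negf[symmetric])
  ultimately have "(\<Sum>i\<le>m. a i * b i) = \<tau> (c \<beta>) - c \<beta>" by simp
  moreover have "a i \<in> K \<and> \<tau> (a i) = a i" if "i \<le> m" for i
    unfolding a_def \<tau>neg \<tau>_mult \<tau>n \<tau>c[OF that] by (intro conjI refl K_minus K_mult K_of_nat cK)
  moreover have "a i0 \<noteq> 0" unfolding a_def inc\<beta> c\<alpha>0 by (metis mult.right_neutral neg_equal_0_iff_equal of_nat_neq_0)
  ultimately have "(\<forall>i\<le>m. a i \<in> K \<and> \<tau> (a i) = a i) \<and> (\<exists>i\<le>m. a i \<noteq> 0) \<and> c \<beta> \<in> K \<and>
      (\<Sum>i\<le>m. a i * b i) = \<tau> (c \<beta>) - c \<beta>"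
    using i0(1) cK by metis
  then show ?thesis by (intro exI)
qed

end

subsection \<open>Weighted walks\<close>

definition step_rel :: "nat \<times> nat \<Rightarrow> nat \<times> nat \<Rightarrow> bool" where
  "step_rel p q \<longleftrightarrow> (int (fst q) - int (fst p), int (snd q) - int (snd p)) \<in> steps_D"

definition walk_set :: "nat \<Rightarrow> nat \<times> nat \<Rightarrow> (nat \<times> nat) list set" where
  "walk_set n q = {p. length p = Suc n \<and> p ! 0 = (0, 0) \<and> p ! n = q \<and>
      (\<forall>k<n. step_rel (p ! k) (p ! Suc k))}"

lemma walks_D_eq_card: "walks_D n i j = card (walk_set n (i, j))"
  by (simp add: walks_D_def walk_set_def step_rel_def)

lemma walk_set_0: "walk_set 0 q = (if q = (0, 0) then {[(0, 0)]} else {})"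
  by (auto simp: walk_set_def length_Suc_conv)

lemma walk_set_Suc: "walk_set (Suc n) q = (\<Union>q'\<in>{q'. step_rel q' q}. (\<lambda>p. p @ [q]) ` walk_set n q')"
proof (intro equalityI subsetI)
  fix p assume p: "p \<in> walk_set (Suc n) q"
  then have len: "length p = Suc (Suc n)" and q: "p ! Suc n = q" by (auto simp: walk_set_def)
  define p' where "p' = butlast p"
  have pp: "p = p' @ [q]"
    using len q unfolding p'_def by (metis append_butlast_last_id diff_Suc_1 last_conv_nth length_0_conv nat.distinct(1))
  have len': "length p' = Suc n" using len by (simp add: p'_def)
  have nth: "p ! k = p' ! k" if "k \<le> n" for k using that len' by (simp add: pp nth_append)
  have st: "step_rel (p ! k) (p ! Suc k)" if "k < Suc n" for k using p that by (auto simp: walk_set_def)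
  have "step_rel (p' ! k) (p' ! Suc k)" if "k < n" for k using st[of k] nth[of k] nth[of "Suc k"] that by simp
  then have "p' \<in> walk_set n (p ! n)" using p len' nth by (auto simp: walk_set_def)
  then show "p \<in> (\<Union>q'\<in>{q'. step_rel q' q}. (\<lambda>p. p @ [q]) ` walk_set n q')"
    using st[of n] q pp by (intro UN_I[of "p ! n"] image_eqI[of _ _ p']) simp_all
next
  fix p assume "p \<in> (\<Union>q'\<in>{q'. step_rel q' q}. (\<lambda>p. p @ [q]) ` walk_set n q')"
  then obtain p' q' where *: "step_rel q' q" "p' \<in> walk_set n q'" "p = p' @ [q]" by auto
  have "step_rel (p ! k) (p ! Suc k)" if "k < Suc n" for k
    using that * by (cases "k = n") (auto simp: walk_set_def nth_append)
  then show "p \<in> walk_set (Suc n) q" using * by (auto simp: walk_set_def nth_append)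
qed

lemma step_rel_preds:
  "{q'. step_rel q' (i, j)} = (if j = 0 then {} else {(Suc i, j - 1), (i, j - 1)})
     \<union> (if i = 0 then {} else {(i - 1, Suc j)})"
  by (auto simp: step_rel_def steps_D_def)

lemma finite_preds: "finite {q'. step_rel q' q}"
  by (cases q) (simp add: step_rel_preds)

lemma finite_walk_set: "finite (walk_set n q)"
  by (induction n arbitrary: q) (auto simp: walk_set_0 walk_set_Suc finite_preds)

lemma card_walk_set_Suc: "card (walk_set (Suc n) q) = (\<Sum>q' | step_rel q' q. card (walk_set n q'))"
proof -
  have "card (walk_set (Suc n) q) = (\<Sum>q' | step_rel q' q. card ((\<lambda>p. p @ [q]) ` walk_set n q'))"
    unfolding walk_set_Suc
    by (intro card_UN_disjoint finite_preds ballI impI finite_imageI finite_walk_set)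
       (auto simp: walk_set_def)
  then show ?thesis by (simp add: card_image inj_on_def)
qed

lemma walks_D_0: "walks_D 0 i j = (if i = 0 \<and> j = 0 then 1 else 0)"
  by (simp add: walks_D_eq_card walk_set_0)

lemma walks_D_Suc:
  "walks_D (Suc n) i j = (if j = 0 then 0 else walks_D n (Suc i) (j - 1) + walks_D n i (j - 1))
     + (if i = 0 then 0 else walks_D n (i - 1) (Suc j))"
proof -
  have "(Suc i, j - 1) \<noteq> (i - 1, Suc j)" "(i, j - 1) \<noteq> (i - 1, Suc j)" by auto
  then show ?thesis
    by (auto simp: walks_D_eq_card card_walk_set_Suc step_rel_preds)
qed

section \<open>Convergence at t = 1/2, and the kernel equation\<close>

definition walk_weight :: "nat \<Rightarrow> nat \<Rightarrow> real" where
  "walk_weight i j = (\<Sum>n. real (walks_D n i j) / 2 ^ n)"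

lemma walks_D_weighted_Suc:
  "2 * (real (walks_D (Suc n) i j) / 2 ^ Suc n) =
     (if j = 0 then 0 else real (walks_D n (Suc i) (j - 1)) / 2 ^ n + real (walks_D n i (j - 1)) / 2 ^ n)
     + (if i = 0 then 0 else real (walks_D n (i - 1) (Suc j)) / 2 ^ n)"
  by (simp add: walks_D_Suc add_divide_distrib)

text \<open>The bounding function is a supersolution of the recurrence: on each antidiagonal it is a
  multiple of the concave function $(i+1)(j+1)$, whose discrete Laplacian is constant.\<close>

lemma walks_D_partial_sum_le:
  "(\<Sum>n<N. real (walks_D n i j) / 2 ^ n) \<le> (fact (i + j + 1))\<^sup>2 * real ((i + 1) * (j + 1))"
proof (induction N arbitrary: i j)
  case 0
  then show ?case by simp
next
  case (Suc N)
  define S where "S i j = (\<Sum>n<N. real (walks_D n i j) / 2 ^ n)" for i j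
  \<comment> \<open>\<open>C\<close> grows by the factor (s+2)^2 from antidiagonal s to the next,
    which dominates (i+1)(j+1) for i + j = s. This absorbs what the step (0,1) carries over from the
    previous antidiagonal.\<close>
  define C where "C s = ((fact (s + 1))\<^sup>2 :: real)" for s
  have S: "S i j \<le> C (i + j) * (real i + 1) * (real j + 1)" for i j
    using Suc.IH[of i j] by (simp add: S_def C_def algebra_simps)
  have "(\<Sum>n<Suc N. real (walks_D n i j) / 2 ^ n)
      = walks_D 0 i j + (\<Sum>n<N. real (walks_D (Suc n) i j) / 2 ^ Suc n)"
    by (subst sum.lessThan_Suc_shift) simp
  also have "(\<Sum>n<N. real (walks_D (Suc n) i j) / 2 ^ Suc n)
      = (\<Sum>n<N. 2 * (real (walks_D (Suc n) i j) / 2 ^ Suc n)) / 2"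
    unfolding sum_distrib_left[symmetric] by simp
  also have "\<dots>
      = ((if j = 0 then 0 else S (Suc i) (j - 1) + S i (j - 1))
         + (if i = 0 then 0 else S (i - 1) (Suc j))) / 2"
    unfolding walks_D_weighted_Suc by (simp add: S_def sum.distrib)
  finally have eq: "(\<Sum>n<Suc N. real (walks_D n i j) / 2 ^ n) = \<dots>
      + walks_D 0 i j" by simp
  have C0: "C s \<ge> 0" for s by (simp add: C_def)
  have CS: "C (Suc s) = (real s + 2)\<^sup>2 * C s" for s
  proof -
    have "(fact (Suc s + 1) :: real) = (real s + 2) * fact (s + 1)" by simp
    then show ?thesis by (simp only: C_def power_mult_distrib)
  qed
  have j: "(if j = 0 then 0 else S (Suc i) (j - 1)) \<le> C (i + j) * (real i + 2) * real j"
    using S[of "Suc i" "j - 1"] by (cases j) (auto simp: algebra_simps)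
  have i: "(if i = 0 then 0 else S (i - 1) (Suc j)) \<le> C (i + j) * (real j + 2) * real i"
    using S[of "i - 1" "Suc j"] by (cases i) (auto simp: algebra_simps)
  \<comment> \<open>The identity (i+2)j + (j+2)i + 2 = 2(i+1)(j+1) leaves exactly
    \<open>2 * C (i + j)\<close> for the inflow from the previous antidiagonal and for the empty
    walk; at the origin this bound is attained.\<close>
  have l: "(if j = 0 then 0 else S i (j - 1)) + 2 * real (walks_D 0 i j) \<le> 2 * C (i + j)"
  proof (cases j)
    case 0
    have "1 \<le> C i" unfolding C_def by (intro one_le_power fact_ge_1)
    then show ?thesis using 0 C0[of i] by (cases "i = 0") (simp_all add: walks_D_0)
  next
    case (Suc j')
    have "S i j' \<le> C (i + j') * ((real i + 1) * (real j' + 1))" using S[of i j'] by (simp add: mult.assoc)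
    also have "\<dots> \<le> C (i + j') * (real (i + j') + 2)\<^sup>2"
      using C0 by (intro mult_left_mono) (auto simp: power2_eq_square intro!: mult_mono)
    also have "\<dots> = C (i + j)" using Suc CS[of "i + j'"] by simp
    finally show ?thesis using C0[of "i + j"] Suc by (simp add: walks_D_0)
  qed
  have "2 * (\<Sum>n<Suc N. real (walks_D n i j) / 2 ^ n) \<le> 2 * (C (i + j) * (real i + 1) * (real j + 1))"
  proof -
    have "2 * (\<Sum>n<Suc N. real (walks_D n i j) / 2 ^ n)
        = (if j = 0 then 0 else S (Suc i) (j - 1)) + (if i = 0 then 0 else S (i - 1) (Suc j))
          + ((if j = 0 then 0 else S i (j - 1)) + 2 * real (walks_D 0 i j))"
      unfolding eq by simp
    also have "\<dots> \<le> C (i + j) * (real i + 2) * real j + C (i + j) * (real j + 2) * real i + 2 * C (i + j)"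
      by (intro add_mono i j l)
    also have "\<dots> = 2 * (C (i + j) * (real i + 1) * (real j + 1))" by (simp add: algebra_simps)
    finally show ?thesis .
  qed
  then show ?case by (simp add: C_def algebra_simps)
qed

lemma summable_walks_D: "summable (\<lambda>n. real (walks_D n i j) / 2 ^ n)"
  by (rule summableI_nonneg_bounded[OF _ walks_D_partial_sum_le]) simp

lemma walk_weight_rec:
  "2 * walk_weight i j = (if i = 0 \<and> j = 0 then 2 else 0)
     + (if j = 0 then 0 else walk_weight (Suc i) (j - 1) + walk_weight i (j - 1))
     + (if i = 0 then 0 else walk_weight (i - 1) (Suc j))"
proof -
  let ?w = "\<lambda>i j n. real (walks_D n i j) / 2 ^ n"
  have sums: "?w i j sums walk_weight i j" for i j
    unfolding walk_weight_def by (rule summable_sums[OF summable_walks_D])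
  have 1: "(\<lambda>n. 2 * ?w i j (Suc n)) sums (2 * (walk_weight i j - ?w i j 0))"
    using sums_mult[OF sums_Suc_imp[of "?w i j", simplified]] sums[of i j]
    by (intro sums_mult) (subst sums_Suc_iff, simp)
  have eq: "2 * ?w i j (Suc n) = (if j = 0 then 0 else ?w (Suc i) (j - 1) n + ?w i (j - 1) n)
     + (if i = 0 then 0 else ?w (i - 1) (Suc j) n)" for n
    by (rule walks_D_weighted_Suc)
  have 2: "(\<lambda>n. 2 * ?w i j (Suc n)) sums
     ((if j = 0 then 0 else walk_weight (Suc i) (j - 1) + walk_weight i (j - 1))
     + (if i = 0 then 0 else walk_weight (i - 1) (Suc j)))"
    unfolding eq using sums by (intro sums_add) (auto intro: sums_add)
  from sums_unique2[OF 1 2] show ?thesis by (simp add: walks_D_0 split: if_splits)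
qed

text \<open>The kernel equation, summed over the antidiagonals $i + j = s$: where the kernel vanishes
  the sum telescopes.\<close>

lemma kernel_telescope:
  fixes g :: "nat \<Rightarrow> nat \<Rightarrow> 'a::comm_ring_1" and x y :: 'a
  assumes rec: "\<And>i j. 2 * g i j = (if i = 0 \<and> j = 0 then 2 else 0)
     + (if j = 0 then 0 else g (Suc i) (j - 1) + g i (j - 1)) + (if i = 0 then 0 else g (i - 1) (Suc j))"
    and kernel: "(x - y)\<^sup>2 + x * y\<^sup>2 = 0"
  shows "x * y\<^sup>2 * (\<Sum>i\<le>s. g i (s - i) * x ^ i * y ^ (s - i))
    = 2 * x * y - (\<Sum>k\<le>s. g k 0 * x ^ (k + 2)) - (\<Sum>k\<le>s. g 0 k * y ^ (k + 2))"
proof (induction s)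
  case 0
  have "x * y\<^sup>2 * g 0 0 = 2 * g 0 0 * x * y - g 0 0 * x\<^sup>2 - g 0 0 * y\<^sup>2"
    using arg_cong[OF kernel, of "\<lambda>z. g 0 0 * z"] by (simp add: power2_eq_square algebra_simps)
  then show ?case using rec[of 0 0] by (simp add: algebra_simps power2_eq_square)
next
  case (Suc s)
  define \<Phi> where "\<Phi> s = (\<Sum>i\<le>s. g i (s - i) * x ^ i * y ^ (s - i))" for s
  let ?t = "Suc s"
  have a: "(\<Sum>i\<le>s. g (Suc i) (s - i) * x ^ Suc i * y ^ (s - i)) = \<Phi> ?t - g 0 ?t * y ^ ?t"
    by (simp add: \<Phi>_def sum.atMost_Suc_shift del: sum.atMost_Suc)
  have b: "(\<Sum>i\<le>s. g i (?t - i) * x ^ i * y ^ (?t - i)) = \<Phi> ?t - g ?t 0 * x ^ ?t"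
    by (simp add: \<Phi>_def)
  \<comment> \<open>Split by the last step. The steps (-1,1) and (1,-1) stay on antidiagonal
    \<open>?t\<close> and reproduce its sum up to one end term each; (0,1) comes from antidiagonal
    \<open>s\<close>. On the kernel curve 2xy - x^2 - y^2 = x y^2, so the three multiples of the new
    sum combine into one.\<close>
  have "2 * x * y * \<Phi> ?t = (\<Sum>i\<le>?t. (2 * g i (?t - i)) * (x ^ Suc i * y ^ Suc (?t - i)))"
    by (simp add: \<Phi>_def sum_distrib_left algebra_simps del: sum.atMost_Suc)
  also have "\<dots> = (\<Sum>i\<le>?t. (if ?t - i = 0 then 0 else g (Suc i) (?t - i - 1) + g i (?t - i - 1)) * (x ^ Suc i * y ^ Suc (?t - i)))
     + (\<Sum>i\<le>?t. (if i = 0 then 0 else g (i - 1) (Suc (?t - i))) * (x ^ Suc i * y ^ Suc (?t - i)))"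
    unfolding rec sum.distrib[symmetric] by (intro sum.cong) (auto simp: algebra_simps)
  also have "(\<Sum>i\<le>?t. (if ?t - i = 0 then 0 else g (Suc i) (?t - i - 1) + g i (?t - i - 1)) * (x ^ Suc i * y ^ Suc (?t - i)))
     = (\<Sum>i\<le>s. (g (Suc i) (s - i) + g i (s - i)) * (x ^ Suc i * y ^ (s - i + 2)))"
    by (simp add: Suc_diff_le)
  also have "\<dots> = y\<^sup>2 * (\<Sum>i\<le>s. g (Suc i) (s - i) * x ^ Suc i * y ^ (s - i)) + x * y\<^sup>2 * \<Phi> s"
    by (simp add: \<Phi>_def sum_distrib_left sum.distrib[symmetric] power_add algebra_simps power2_eq_square)
  also have "(\<Sum>i\<le>?t. (if i = 0 then 0 else g (i - 1) (Suc (?t - i))) * (x ^ Suc i * y ^ Suc (?t - i)))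
     = x\<^sup>2 * (\<Sum>i\<le>s. g i (?t - i) * x ^ i * y ^ (?t - i))"
    unfolding sum.atMost_Suc_shift
    by (simp add: sum_distrib_left power2_eq_square mult_ac Suc_diff_le)
  finally have "2 * x * y * \<Phi> ?t = y\<^sup>2 * (\<Phi> ?t - g 0 ?t * y ^ ?t) + x * y\<^sup>2 * \<Phi> s + x\<^sup>2 * (\<Phi> ?t - g ?t 0 * x ^ ?t)"
    unfolding a b .
  then have "x * y\<^sup>2 * \<Phi> ?t - x * y\<^sup>2 * \<Phi> s
      = ((x - y)\<^sup>2 + x * y\<^sup>2) * \<Phi> ?t - g ?t 0 * x ^ (?t + 2) - g 0 ?t * y ^ (?t + 2)"
    by (simp add: power2_eq_square algebra_simps)
  then have *: "x * y\<^sup>2 * \<Phi> ?t - x * y\<^sup>2 * \<Phi> s = - g ?t 0 * x ^ (?t + 2) - g 0 ?t * y ^ (?t + 2)"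
    unfolding kernel by simp
  have "x * y\<^sup>2 * \<Phi> ?t = x * y\<^sup>2 * \<Phi> s + (x * y\<^sup>2 * \<Phi> ?t - x * y\<^sup>2 * \<Phi> s)" by simp
  also have "\<dots> = x * y\<^sup>2 * \<Phi> s - g ?t 0 * x ^ (?t + 2) - g 0 ?t * y ^ (?t + 2)" unfolding * by simp
  also have "\<dots> = 2 * x * y - ((\<Sum>k\<le>s. g k 0 * x ^ (k + 2)) + g ?t 0 * x ^ (?t + 2))
      - ((\<Sum>k\<le>s. g 0 k * y ^ (k + 2)) + g 0 ?t * y ^ (?t + 2))"
    unfolding \<Phi>_def Suc.IH by (simp only: algebra_simps)
  finally show ?case unfolding \<Phi>_def by (simp only: sum.atMost_Suc)
qed

subsection \<open>Bernoulli numbers\<close>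

abbreviation bernoulli_egf :: "real fps" where
  "bernoulli_egf \<equiv> fps_X / (fps_exp 1 - 1)"

text \<open>Division of power series can be undone only when the denominator divides the numerator,
  hence the comparison of subdegrees.\<close>

lemma bernoulli_egf_mult: "bernoulli_egf * (fps_exp 1 - 1) = fps_X"
proof -
  let ?E = "fps_exp 1 - 1 :: real fps"
  have nz: "?E \<noteq> 0"
  proof
    assume "?E = 0"
    then have "fps_nth ?E 1 = 0" by simp
    then show False by simp
  qed
  have "subdegree ?E = 1" by (rule subdegreeI) auto
  then have "?E dvd fps_X" using nz by (simp add: fps_dvd_iff)
  then show ?thesis by simp
qed

lemma bernoulli_num_eq: "fps_nth bernoulli_egf n = bernoulli_num n / fact n"
  by (simp add: bernoulli_num_def)

lemma bernoulli_num_sum: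
  "(\<Sum>j<n. real (n choose j) * bernoulli_num j) = (if n = 1 then 1 else 0)"
proof -
  have "fps_nth (bernoulli_egf * (fps_exp 1 - 1)) n
      = (\<Sum>j\<in>{0..n}. fps_nth bernoulli_egf j * fps_nth (fps_exp 1 - 1) (n - j))"
    by (simp add: fps_mult_nth)
  also have "\<dots> = (\<Sum>j<n. fps_nth bernoulli_egf j * fps_nth (fps_exp 1 - 1) (n - j))"
    by (intro sum.mono_neutral_right) auto
  also have "\<dots> = (\<Sum>j<n. bernoulli_num j / fact j * (1 / fact (n - j)))"
    by (intro sum.cong) (auto simp: bernoulli_num_eq)
  finally have "(if n = 1 then 1 else 0) = (\<Sum>j<n. bernoulli_num j / fact j * (1 / fact (n - j)))"
    unfolding bernoulli_egf_mult by (simp add: fps_X_nth)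
  then have "fact n * (if n = 1 then 1 else 0 :: real)
      = (\<Sum>j<n. fact n * (bernoulli_num j / fact j * (1 / fact (n - j))))"
    by (simp add: sum_distrib_left)
  also have "\<dots> = (\<Sum>j<n. real (n choose j) * bernoulli_num j)"
    by (intro sum.cong) (auto simp: binomial_fact field_simps)
  finally show ?thesis by (simp split: if_splits)
qed

lemma bernoulli_egf_reflect: "bernoulli_egf oo (- fps_X) = bernoulli_egf + fps_X"
proof -
  let ?b = bernoulli_egf and ?e = "fps_exp 1 :: real fps"
  have "(?b * (?e - 1)) oo (- fps_X) = - fps_X" unfolding bernoulli_egf_mult by simp
  then have "(?b oo (- fps_X)) * (fps_exp (-1) - 1) = - fps_X"
    by (simp add: fps_compose_mult_distrib fps_compose_sub_distrib)
  then have "(?b oo (- fps_X)) * (fps_exp (-1) - 1) * ?e = - fps_X * ?e" by simp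
  then have 1: "(?b oo (- fps_X)) * (fps_exp (-1) * ?e - ?e) = - fps_X * ?e"
    by (simp add: algebra_simps)
  have 2: "fps_exp (-1) * ?e = 1" using fps_exp_add_mult[of "-1" "1::real"] by simp
  have "(?b oo (- fps_X)) * (?e - 1) = - ((?b oo (- fps_X)) * (1 - ?e))" by (simp add: algebra_simps)
  also have "\<dots> = fps_X * ?e" using 1 unfolding 2 by simp
  also have "fps_X * ?e = ?b * (?e - 1) + fps_X * (?e - 1)" unfolding bernoulli_egf_mult by (simp add: algebra_simps)
  finally have "((?b oo (- fps_X)) - (?b + fps_X)) * (?e - 1) = 0" by (simp add: algebra_simps)
  moreover have "?e - 1 \<noteq> 0" using bernoulli_egf_mult by auto
  ultimately show ?thesis by simp
qed

lemma bernoulli_num_odd: "odd n \<Longrightarrow> n \<noteq> 1 \<Longrightarrow> bernoulli_num n = 0"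
proof -
  assume n: "odd n" "n \<noteq> 1"
  have "fps_nth (bernoulli_egf oo (- fps_X)) n = - fps_nth bernoulli_egf n"
    using n by (simp add: fps_compose_uminus')
  then have "fps_nth bernoulli_egf n = 0"
    unfolding bernoulli_egf_reflect using n by (simp add: fps_X_nth)
  then show ?thesis by (simp add: bernoulli_num_def)
qed

lemma bernoulli_num_0: "bernoulli_num 0 = 1"
  using bernoulli_num_sum[of 1] by simp

text \<open>Differentiating b (e^x - 1) = x and multiplying by b eliminates the exponential.\<close>

lemma bernoulli_egf_square:
  "bernoulli_egf\<^sup>2 = bernoulli_egf - fps_X * bernoulli_egf - fps_X * fps_deriv bernoulli_egf"
proof -
  let ?b = bernoulli_egf and ?e = "fps_exp 1 :: real fps"
  have "fps_deriv (?b * (?e - 1)) = 1" unfolding bernoulli_egf_mult by simp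
  then have "fps_deriv ?b * (?e - 1) + ?b * (?e - 1) + ?b = 1" by (simp add: algebra_simps)
  then have "?b * (fps_deriv ?b * (?e - 1) + ?b * (?e - 1) + ?b) = ?b" by simp
  then have "fps_deriv ?b * (?b * (?e - 1)) + ?b * (?b * (?e - 1)) + ?b * ?b = ?b" by (simp only: algebra_simps)
  then show ?thesis unfolding bernoulli_egf_mult by (simp add: power2_eq_square algebra_simps)
qed

text \<open>The coefficient of x^(2n+2) in the previous identity. In its square the terms of odd
  index vanish, those containing B_1 because their partner has index 2n+1, at least 3; the two end
  terms are moved to the right.\<close>

lemma bernoulli_num_convolution:
  assumes "n \<ge> 1"
  shows "(\<Sum>l<n. bernoulli_num (2 * l + 2) / fact (2 * l + 2) * (bernoulli_num (2 * (n - l)) / fact (2 * (n - l))))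
    = - (2 * real n + 3) * (bernoulli_num (2 * n + 2) / fact (2 * n + 2))"
proof -
  define \<beta> where "\<beta> k = fps_nth bernoulli_egf k" for k
  let ?N = "2 * n + 2"
  have \<beta>0: "\<beta> 0 = 1" by (simp add: \<beta>_def bernoulli_num_eq bernoulli_num_0 del: fps_divide_nth_0)
  have odd: "\<beta> k = 0" if "odd k" "k \<noteq> 1" for k using bernoulli_num_odd[OF that] by (simp add: \<beta>_def bernoulli_num_eq)
  have "(\<Sum>k\<le>?N. \<beta> k * \<beta> (?N - k)) = fps_nth (bernoulli_egf\<^sup>2) ?N"
    by (simp add: power2_eq_square fps_mult_nth \<beta>_def atLeast0AtMost)
  also have "\<dots> = \<beta> ?N - \<beta> (?N - 1) - real ?N * \<beta> ?N"
    unfolding bernoulli_egf_square by (simp add: \<beta>_def)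
  also have "\<beta> (?N - 1) = 0" using assms by (intro odd) auto
  finally have sq: "(\<Sum>k\<le>?N. \<beta> k * \<beta> (?N - k)) = (1 - real ?N) * \<beta> ?N" by (simp add: algebra_simps)
  have "(\<Sum>k\<le>?N. \<beta> k * \<beta> (?N - k)) = (\<Sum>k\<in>(\<lambda>l. 2 * l) ` {..Suc n}. \<beta> k * \<beta> (?N - k))"
  proof (intro sum.mono_neutral_right ballI)
    fix k assume k: "k \<in> {..?N} - (\<lambda>l. 2 * l) ` {..Suc n}"
    have "odd k"
    proof
      assume "even k"
      then obtain l where "k = 2 * l" by blast
      then show False using k by auto
    qed
    moreover have "\<beta> (?N - 1) = 0" using assms by (intro odd) auto
    ultimately have "\<beta> k = 0 \<or> \<beta> (?N - k) = 0" using odd by (cases "k = 1") blast+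
    then show "\<beta> k * \<beta> (?N - k) = 0" by simp
  qed auto
  also have "\<dots> = (\<Sum>l\<le>Suc n. \<beta> (2 * l) * \<beta> (?N - 2 * l))"
    by (subst sum.reindex) (auto simp: inj_on_def)
  also have "\<dots> = 2 * \<beta> ?N + (\<Sum>l<n. \<beta> (2 * l + 2) * \<beta> (2 * (n - l)))"
  proof -
    have "(\<Sum>l\<le>Suc n. \<beta> (2 * l) * \<beta> (?N - 2 * l)) = (\<Sum>l\<le>n. \<beta> (2 * l) * \<beta> (?N - 2 * l)) + \<beta> ?N"
      by (simp add: \<beta>0)
    also have "(\<Sum>l\<le>n. \<beta> (2 * l) * \<beta> (?N - 2 * l)) = \<beta> ?N + (\<Sum>l<n. \<beta> (2 * l + 2) * \<beta> (2 * (n - l)))"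
      unfolding lessThan_Suc_atMost[symmetric] sum.lessThan_Suc_shift
      by (simp add: \<beta>0 diff_mult_distrib2)
    finally show ?thesis by simp
  qed
  finally have "(\<Sum>l<n. \<beta> (2 * l + 2) * \<beta> (2 * (n - l))) = - (2 * real n + 3) * \<beta> ?N"
    using sq by (simp add: algebra_simps)
  then show ?thesis by (simp only: \<beta>_def bernoulli_num_eq)
qed

subsection \<open>The shift of $1/u$ and the Bernoulli series\<close>

text \<open>The expansion of u/(1-u) = 1/(v-1), so that composing with it is the shift v -> v -
  1.\<close>

definition shift_series :: "complex fps" where
  "shift_series = Abs_fps (\<lambda>n. if n = 0 then 0 else 1)"

lemma shift_series_0 [simp]: "fps_nth shift_series 0 = 0"
  by (simp add: shift_series_def)

lemma shift_series_nonzero [simp]: "shift_series \<noteq> 0"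
proof
  assume "shift_series = 0"
  then have "fps_nth shift_series 1 = 0" by simp
  then show False by (simp add: shift_series_def)
qed

lemma shift_series_eq: "shift_series = fps_X + fps_X * shift_series"
  by (rule fps_ext) (auto simp: shift_series_def fps_X_nth)

text \<open>Multiplying h = X + X h by a power of h yields Pascal's rule for the
  coefficients.\<close>

lemma shift_series_power_nth:
  "fps_nth (shift_series ^ Suc j) n = (if n = 0 then 0 else of_nat ((n - 1) choose j))"
proof (induction j arbitrary: n)
  case 0
  then show ?case by (simp add: shift_series_def)
next
  case (Suc j)
  have eq: "shift_series ^ Suc (Suc j) = fps_X * shift_series ^ Suc j + fps_X * shift_series ^ Suc (Suc j)"
    by (subst (1) power_Suc, subst (1) shift_series_eq) (simp add: algebra_simps)
  show ?case
  proof (induction n)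
    case 0
    show ?case by (subst eq) (simp del: power_Suc)
  next
    case (Suc n)
    have "fps_nth (shift_series ^ Suc (Suc j)) (Suc n)
        = fps_nth (shift_series ^ Suc j) n + fps_nth (shift_series ^ Suc (Suc j)) n"
      by (subst eq) (simp del: power_Suc)
    then show ?case unfolding Suc.IH \<open>\<And>n. fps_nth (shift_series ^ Suc j) n = _\<close>
      by (cases n) (simp_all del: power_Suc)
  qed
qed

text \<open>The shift acts as a binomial transform of the coefficients, which is how the recurrence
  of the Bernoulli numbers enters.\<close>

lemma fps_compose_shift_nth_Suc:
  "fps_nth (F oo shift_series) (Suc n) = (\<Sum>i\<le>n. fps_nth F (Suc i) * of_nat (n choose i))"
proof -
  have "fps_nth (F oo shift_series) (Suc n) = (\<Sum>i\<le>Suc n. fps_nth F i * fps_nth (shift_series ^ i) (Suc n))"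
    by (simp add: fps_compose_nth atLeast0AtMost)
  also have "\<dots> = (\<Sum>i\<le>n. fps_nth F (Suc i) * fps_nth (shift_series ^ Suc i) (Suc n))"
    by (subst sum.atMost_Suc_shift) simp
  finally show ?thesis unfolding shift_series_power_nth by simp
qed

text \<open>Comparing coefficients at index n+2, the leading terms cancel and the next one leaves
  (n+1) F_(n+1) = 0, once the lower coefficients are known to vanish.\<close>

lemma shift_invariant_imp_const:
  assumes "F oo shift_series = F"
  shows "F = fps_const (fps_nth F 0)"
proof -
  have "fps_nth F (Suc n) = 0" for n
  proof (induction n rule: less_induct)
    case (less n)
    have "fps_nth F (Suc (Suc n)) = (\<Sum>i\<le>Suc n. fps_nth F (Suc i) * of_nat (Suc n choose i))"
      using fps_compose_shift_nth_Suc[of F "Suc n"] assms by simp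
    also have "\<dots> = (\<Sum>i\<in>{n, Suc n}. fps_nth F (Suc i) * of_nat (Suc n choose i))"
      using less by (intro sum.mono_neutral_right) auto
    finally have "fps_nth F (Suc (Suc n)) = fps_nth F (Suc n) * of_nat (Suc n) + fps_nth F (Suc (Suc n))"
      by simp
    then have "fps_nth F (Suc n) * of_nat (Suc n) = 0" by (metis add_cancel_right_left)
    then show ?case by (metis mult_eq_0_iff of_nat_neq_0)
  qed
  then have "fps_nth F n = fps_nth (fps_const (fps_nth F 0)) n" for n by (cases n) simp_all
  then show ?thesis by (rule fps_ext)
qed

text \<open>The sum of (k+1) B_k u^(k+2), that is, the asymptotic expansion of -psi''(v+1) for u =
  1/v. Its shift equation mirrors psi''(v+1) = psi''(v) + 2/v^3.\<close>

definition bernoulli_series :: "complex fps" where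
  "bernoulli_series = Abs_fps (\<lambda>n. if n < 2 then 0 else of_nat (n - 1) * of_real (bernoulli_num (n - 2)))"

text \<open>By (i+1) binom(k+1,i+1) = (k+1) binom(k,i) the transform becomes the Bernoulli
  recurrence, whose exceptional value at k = 1 produces 2 u^3.\<close>

lemma bernoulli_series_shift: "bernoulli_series oo shift_series = bernoulli_series + fps_const 2 * fps_X ^ 3"
proof (rule fps_ext)
  fix n
  show "fps_nth (bernoulli_series oo shift_series) n = fps_nth (bernoulli_series + fps_const 2 * fps_X ^ 3) n"
  proof (cases "n < 2")
    case True
    then consider "n = 0" | "n = Suc 0" by linarith
    then show ?thesis
      by cases (simp_all only: fps_compose_shift_nth_Suc, simp_all add: bernoulli_series_def fps_X_power_nth)
  next
    case False
    then obtain k where n: "n = Suc (Suc k)" by (metis add_2_eq_Suc le_Suc_ex not_le)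
    have "fps_nth (bernoulli_series oo shift_series) n
        = (\<Sum>i\<le>k. fps_nth bernoulli_series (Suc (Suc i)) * of_nat (Suc k choose Suc i))"
      unfolding n fps_compose_shift_nth_Suc sum.atMost_Suc_shift by (simp add: bernoulli_series_def)
    also have "\<dots> = (\<Sum>i\<le>k. of_nat (Suc k) * of_real (real (k choose i) * bernoulli_num i))"
    proof (intro sum.cong refl)
      fix i
      have "of_nat (Suc i) * (of_nat (Suc k choose Suc i)) = (of_nat (Suc k) * of_nat (k choose i) :: complex)"
        unfolding of_nat_mult[symmetric] Suc_times_binomial ..
      then show "fps_nth bernoulli_series (Suc (Suc i)) * of_nat (Suc k choose Suc i)
          = of_nat (Suc k) * of_real (real (k choose i) * bernoulli_num i)"
        by (simp add: bernoulli_series_def mult_ac del: of_nat_Suc)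
    qed
    also have "\<dots> = of_nat (Suc k) * of_real (\<Sum>i\<le>k. real (k choose i) * bernoulli_num i)"
      by (simp add: sum_distrib_left)
    also have "(\<Sum>i\<le>k. real (k choose i) * bernoulli_num i) = bernoulli_num k + (if k = 1 then 1 else 0)"
      using bernoulli_num_sum[of k] by (simp add: lessThan_Suc_atMost[symmetric])
    finally show ?thesis
      by (auto simp: n bernoulli_series_def fps_X_power_nth numeral_eq_Suc algebra_simps)
  qed
qed

subsection \<open>The kernel method\<close>

text \<open>As \<open>x\<close> has no constant term, high powers do not reach coefficient
  \<open>n\<close>; the composition may be replaced there by the truncated boundary sums of
  \<open>kernel_telescope\<close>.\<close>

lemma fps_compose_shifted_nth:
  fixes x :: "'a::comm_ring_1 fps"
  assumes "fps_nth x 0 = 0"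
  shows "fps_nth (Abs_fps (\<lambda>n. if n < 2 then 0 else d (n - 2)) oo x) n
    = fps_nth (\<Sum>k\<le>n. fps_const (d k) * x ^ (k + 2)) n"
proof -
  let ?F = "Abs_fps (\<lambda>n. if n < 2 then 0 else d (n - 2))"
  have zero: "fps_nth (x ^ i) n = 0" if "n < i" for i
    using startsby_zero_power_prefix[OF assms] that by simp
  have "fps_nth (?F oo x) n = (\<Sum>i\<le>n. fps_nth ?F i * fps_nth (x ^ i) n)"
    by (simp add: fps_compose_nth atLeast0AtMost)
  also have "\<dots> = (\<Sum>i\<le>Suc (Suc n). fps_nth ?F i * fps_nth (x ^ i) n)"
    by (intro sum.mono_neutral_left) (auto simp: zero)
  also have "\<dots> = (\<Sum>k\<le>n. d k * fps_nth (x ^ (k + 2)) n)"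
    unfolding sum.atMost_Suc_shift by simp
  also have "\<dots> = fps_nth (\<Sum>k\<le>n. fps_const (d k) * x ^ (k + 2)) n"
    by (simp add: fps_sum_nth)
  finally show ?thesis .
qed

text \<open>The boundary series times x^2 (and y^2 for the next one), matching the exponents
  \<open>k + 2\<close> in \<open>kernel_telescope\<close>.\<close>

definition walk_gf_x :: "complex fps" where
  "walk_gf_x = Abs_fps (\<lambda>n. if n < 2 then 0 else of_real (walk_weight (n - 2) 0))"

definition walk_gf_y :: "complex fps" where
  "walk_gf_y = Abs_fps (\<lambda>n. if n < 2 then 0 else of_real (walk_weight 0 (n - 2)))"

text \<open>When x and y are divisible by u, the antidiagonal sum on the left of
  \<open>kernel_telescope\<close> is divisible by u^(n+1) and so is invisible at coefficient
  \<open>n\<close>. No two-variable series has to be formed.\<close>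

lemma walk_gf_kernel:
  fixes x y :: "complex fps"
  assumes x0: "fps_nth x 0 = 0" and y0: "fps_nth y 0 = 0" and kernel: "(x - y)\<^sup>2 + x * y\<^sup>2 = 0"
  shows "(walk_gf_x oo x) + (walk_gf_y oo y) = 2 * x * y"
proof (rule fps_ext)
  fix n
  define g where "g i j = fps_const (complex_of_real (walk_weight i j))" for i j
  have rec: "2 * g i j = (if i = 0 \<and> j = 0 then 2 else 0)
     + (if j = 0 then 0 else g (Suc i) (j - 1) + g i (j - 1)) + (if i = 0 then 0 else g (i - 1) (Suc j))" for i j
  proof -
    have "2 * g i j = fps_const (complex_of_real (2 * walk_weight i j))"
      by (simp add: g_def numeral_fps_const)
    then show ?thesis
      unfolding walk_weight_rec by (auto simp: g_def numeral_fps_const)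
  qed
  have factor: "z = fps_X * fps_shift 1 z" if "fps_nth z 0 = 0" for z :: "complex fps"
    using that by (intro fps_ext) auto
  obtain x' where x: "x = fps_X * x'"
    using factor[OF x0] by blast
  obtain y' where y: "y = fps_X * y'"
    using factor[OF y0] by blast
  have "x * y\<^sup>2 * (\<Sum>i\<le>n. g i (n - i) * x ^ i * y ^ (n - i))
      = fps_X ^ Suc n * (fps_X\<^sup>2 * x' * y'\<^sup>2 * (\<Sum>i\<le>n. g i (n - i) * x' ^ i * y' ^ (n - i)))"
  proof -
    have "g i (n - i) * x ^ i * y ^ (n - i) = fps_X ^ n * (g i (n - i) * x' ^ i * y' ^ (n - i))" if "i \<le> n" for i
    proof -
      have "fps_X ^ n = (fps_X ^ i * fps_X ^ (n - i) :: complex fps)"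
        using that by (simp add: power_add[symmetric])
      then show ?thesis by (simp add: x y power_mult_distrib mult_ac)
    qed
    then have "(\<Sum>i\<le>n. g i (n - i) * x ^ i * y ^ (n - i))
        = fps_X ^ n * (\<Sum>i\<le>n. g i (n - i) * x' ^ i * y' ^ (n - i))"
      unfolding sum_distrib_left by (intro sum.cong) auto
    then show ?thesis by (simp add: x y power_mult_distrib power2_eq_square mult_ac)
  qed
  then have "fps_nth (x * y\<^sup>2 * (\<Sum>i\<le>n. g i (n - i) * x ^ i * y ^ (n - i))) n = 0"
    by (simp add: fps_X_power_mult_nth del: power_Suc)
  then have "fps_nth (2 * x * y - (\<Sum>k\<le>n. g k 0 * x ^ (k + 2)) - (\<Sum>k\<le>n. g 0 k * y ^ (k + 2))) n = 0"
    unfolding kernel_telescope[OF rec kernel] .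
  then show "fps_nth ((walk_gf_x oo x) + (walk_gf_y oo y)) n = fps_nth (2 * x * y) n"
    unfolding walk_gf_x_def walk_gf_y_def g_def
    using fps_compose_shifted_nth[OF x0, of "\<lambda>k. of_real (walk_weight k 0)" n]
      fps_compose_shifted_nth[OF y0, of "\<lambda>k. of_real (walk_weight 0 k)" n]
    by (simp add: algebra_simps)
qed

text \<open>The outer series is \<open>shift_series\<close> itself, written by its functional
  equation: u -> -u/(1-u) is an involution, being v -> 1 - v.\<close>

lemma shift_series_reflect: "(fps_X + fps_X * shift_series) oo (- shift_series) = - fps_X"
proof -
  let ?h = shift_series
  have "?h oo (- ?h) = - ?h + (- ?h) * (?h oo (- ?h))"
    by (subst (1) shift_series_eq) (simp add: fps_compose_add_distrib fps_compose_mult_distrib)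
  then have 1: "(1 + ?h) * (?h oo (- ?h)) = - ?h" by (simp add: algebra_simps)
  have 2: "fps_X * (1 + ?h) = ?h" using shift_series_eq by (simp add: algebra_simps)
  have "(1 + ?h) * ((?h oo (- ?h)) + fps_X) = 0" using 1 2 by (simp add: algebra_simps)
  moreover have "1 + ?h \<noteq> 0"
  proof
    assume "1 + ?h = 0"
    then have "fps_nth (1 + ?h) 0 = 0" by simp
    then show False by simp
  qed
  ultimately have "(?h oo (- ?h)) + fps_X = 0" by simp
  then show ?thesis using shift_series_eq by (simp add: eq_neg_iff_add_eq_0)
qed

text \<open>On the kernel curve, parametrised by $x = -u^2$, $y = -u^2/(1-u)$, the coordinate $x$ is
  invariant under $u \mapsto -u$ and $y$ under $u \mapsto -u/(1-u)$. Their composition is the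
  shift $1/u \mapsto 1/u - 1$, so eliminating the $y$-part leaves a difference equation.\<close>

lemma walk_gf_shift:
  defines "a \<equiv> walk_gf_x oo (- (fps_X\<^sup>2))"
  shows "(a oo shift_series) - a = 2 * fps_X * shift_series * (shift_series\<^sup>2 - fps_X\<^sup>2)"
proof -
  let ?h = shift_series and ?x = "- (fps_X\<^sup>2) :: complex fps"
  define y where "y = - (fps_X * ?h)"
  have Xh: "fps_X * ?h = ?h - fps_X" using shift_series_eq by (simp add: algebra_simps)
  have "(?x - y)\<^sup>2 + ?x * y\<^sup>2 = fps_X\<^sup>2 * ((?h - fps_X)\<^sup>2 - (fps_X * ?h)\<^sup>2)"
    by (simp add: y_def power2_eq_square algebra_simps)
  then have kernel: "(?x - y)\<^sup>2 + ?x * y\<^sup>2 = 0" unfolding Xh by simp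
  have h_refl: "?h oo (- ?h) = - fps_X"
    using shift_series_reflect shift_series_eq by simp
  have y0: "fps_nth y 0 = 0" by (simp add: y_def)
  have yh: "y oo (- ?h) = y"
    by (simp add: y_def fps_compose_uminus fps_compose_mult_distrib h_refl mult.commute)
  have xh: "?x oo (- ?h) = - (?h\<^sup>2)" "?x oo ?h = - (?h\<^sup>2)"
    by (simp_all add: fps_compose_uminus fps_compose_power[symmetric])
  have eq1: "a + (walk_gf_y oo y) = 2 * ?x * y"
    unfolding a_def by (rule walk_gf_kernel[OF _ _ kernel]) (simp_all add: y_def)
  then have "(a + (walk_gf_y oo y)) oo (- ?h) = (2 * ?x * y) oo (- ?h)" by simp
  \<comment> \<open>\<open>a\<close> is even in u, so -h and h give the same series; this turns the
    involution fixing y into the shift.\<close>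
  moreover have "a oo (- ?h) = a oo ?h"
    unfolding a_def by (subst (1 2) fps_compose_assoc[symmetric]) (simp_all add: xh)
  moreover have "(walk_gf_y oo y) oo (- ?h) = walk_gf_y oo y"
    by (subst fps_compose_assoc[symmetric]) (simp_all add: yh y0)
  moreover have "(2 * ?x * y) oo (- ?h) = 2 * (- (?h\<^sup>2)) * y"
    by (simp add: fps_compose_uminus fps_compose_mult_distrib fps_compose_power[symmetric] yh)
  ultimately have eq2: "(a oo ?h) + (walk_gf_y oo y) = 2 * (- (?h\<^sup>2)) * y"
    by (simp add: fps_compose_add_distrib)
  have "(a oo ?h) - a = ((a oo ?h) + (walk_gf_y oo y)) - (a + (walk_gf_y oo y))" by simp
  also have "\<dots> = 2 * fps_X * ?h * (?h\<^sup>2 - fps_X\<^sup>2)"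
    unfolding eq1 eq2 by (simp add: y_def algebra_simps power2_eq_square)
  finally show ?thesis .
qed

text \<open>Both sides have the same shift difference and no constant term. The added polynomial
  cancels the B_0 and B_1 terms, in accordance with a left side that starts at u^4.\<close>

lemma walk_gf_eq_bernoulli_series:
  "walk_gf_x oo (- (fps_X\<^sup>2)) = 2 * bernoulli_series - 2 * fps_X\<^sup>2 + 2 * fps_X ^ 3"
proof -
  let ?h = shift_series
  define a where "a = walk_gf_x oo (- (fps_X\<^sup>2))"
  define T where "T = 2 * bernoulli_series - 2 * fps_X\<^sup>2 + 2 * fps_X ^ 3"
  have Xh: "fps_X * ?h = ?h - fps_X" using shift_series_eq by (simp add: algebra_simps)
  have c: "2 * F oo ?h = 2 * (F oo ?h)" for F :: "complex fps"
    by (simp add: fps_compose_mult_distrib)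
  have "(T oo ?h) - T = 4 * fps_X ^ 3 - 2 * (?h\<^sup>2 - fps_X\<^sup>2) + 2 * (?h ^ 3 - fps_X ^ 3)"
    by (simp add: T_def fps_compose_add_distrib fps_compose_sub_distrib c fps_compose_power[symmetric]
        bernoulli_series_shift[folded numeral_fps_const])
  also have "\<dots> = 2 * (fps_X ^ 3 - (?h - fps_X) * (?h + fps_X) + ?h ^ 3)"
    by (simp add: algebra_simps power2_eq_square)
  also have "(?h - fps_X) * (?h + fps_X) = fps_X * ?h * (?h + fps_X)" unfolding Xh ..
  also have "2 * (fps_X ^ 3 - fps_X * ?h * (?h + fps_X) + ?h ^ 3) = 2 * (?h - fps_X) * (?h\<^sup>2 - fps_X\<^sup>2)"
    by (simp add: algebra_simps power2_eq_square power3_eq_cube)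
  also have "\<dots> = (a oo ?h) - a"
    unfolding walk_gf_shift[folded a_def] by (simp add: Xh[symmetric] mult_ac)
  finally have "(a - T) oo ?h = a - T" by (simp add: fps_compose_sub_distrib algebra_simps)
  then have "a - T = fps_const (fps_nth (a - T) 0)" by (rule shift_invariant_imp_const)
  also have "fps_nth (a - T) 0 = 0"
    by (simp add: a_def T_def walk_gf_x_def bernoulli_series_def numeral_fps_const)
  finally show ?thesis by (simp add: a_def T_def)
qed

lemma walk_weight_eq_bernoulli:
  "walk_weight n 0 = 2 * (2 * real n + 3) * bernoulli_num (2 * n + 2) * (-1) ^ n"
proof -
  have pow: "(- (fps_X\<^sup>2)) ^ i = fps_const ((-1) ^ i) * (fps_X ^ (2 * i) :: complex fps)" for i
  proof -
    have "(- (fps_X\<^sup>2)) ^ i = (-1) ^ i * (fps_X\<^sup>2 :: complex fps) ^ i" by (rule power_minus)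
    also have "(-1 :: complex fps) ^ i = fps_const ((-1) ^ i)"
      by (metis fps_const_neg fps_const_power fps_const_1_eq_1)
    finally show ?thesis by (simp add: power_mult)
  qed
  have "fps_nth (walk_gf_x oo (- (fps_X\<^sup>2))) (2 * n + 4)
      = (\<Sum>i\<le>2 * n + 4. if i = n + 2 then (-1) ^ n * of_real (walk_weight n 0) else 0)"
    unfolding fps_compose_nth atLeast0AtMost
    by (intro sum.cong) (auto simp: pow walk_gf_x_def fps_X_power_nth)
  also have "\<dots> = (-1) ^ n * of_real (walk_weight n 0)" by simp
  finally have "(-1) ^ n * complex_of_real (walk_weight n 0)
      = 2 * of_nat (2 * n + 3) * of_real (bernoulli_num (2 * n + 2))"
    unfolding walk_gf_eq_bernoulli_series
    by (simp add: bernoulli_series_def numeral_fps_const fps_X_power_nth eval_nat_numeral)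
      (simp add: algebra_simps)
  also have "\<dots> = of_real (2 * (2 * real n + 3) * bernoulli_num (2 * n + 2))" by simp
  finally have "of_real ((-1) ^ n * walk_weight n 0) = complex_of_real (2 * (2 * real n + 3) * bernoulli_num (2 * n + 2))"
    by simp
  then have "(-1) ^ n * walk_weight n 0 = 2 * (2 * real n + 3) * bernoulli_num (2 * n + 2)"
    unfolding of_real_eq_iff .
  then have "(-1) ^ n * ((-1) ^ n * walk_weight n 0) = 2 * (2 * real n + 3) * bernoulli_num (2 * n + 2) * (-1) ^ n"
    by simp
  then show ?thesis by (simp add: power_mult_distrib[symmetric] mult.assoc[symmetric])
qed

lemma dcoeff_eq_bernoulli: "dcoeff n = 2 * (2 * real n + 3) * bernoulli_num (2 * n + 2) * (-1) ^ n"
  unfolding dcoeff_def walk_weight_eq_bernoulli[symmetric] walk_weight_def ..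

text \<open>Since (2l+3)(2l+2)! = (2l+3)!, the coefficient is 2 (-1)^l (2l+3)! B_(2l+2)/(2l+2)!. The
  two factorials in a product have arguments adding up to 2n+4, so the binomial coefficient turns
  them into (2n+4)! and \<open>bernoulli_num_convolution\<close> remains.\<close>

lemma dcoeff_convolution:
  assumes "n \<ge> 1"
  shows "4 * (real n + 2) * (2 * real n + 3) * dcoeff n
    = (\<Sum>l<n. real ((2 * n + 4) choose (2 * l + 3)) * dcoeff l * dcoeff (n - 1 - l))"
proof -
  define \<beta> where "\<beta> k = bernoulli_num k / fact k" for k
  have d: "dcoeff l = 2 * fact (2 * l + 3) * \<beta> (2 * l + 2) * (-1) ^ l" for l
  proof -
    have "(fact (2 * l + 3) :: real) = (2 * real l + 3) * fact (2 * l + 2)"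
      by (simp add: eval_nat_numeral algebra_simps)
    then show ?thesis by (simp add: dcoeff_eq_bernoulli \<beta>_def)
  qed
  have "real ((2 * n + 4) choose (2 * l + 3)) * dcoeff l * dcoeff (n - 1 - l)
      = 4 * fact (2 * n + 4) * (-1) ^ (n - 1) * (\<beta> (2 * l + 2) * \<beta> (2 * (n - l)))" if "l < n" for l
  proof -
    have idx: "2 * (n - 1 - l) + 3 = 2 * n + 4 - (2 * l + 3)" "2 * (n - 1 - l) + 2 = 2 * (n - l)"
      using that by auto
    have sg: "(-1 :: real) ^ l * (-1) ^ (n - 1 - l) = (-1) ^ (n - 1)"
      using that by (simp add: power_add[symmetric])
    have "real ((2 * n + 4) choose (2 * l + 3)) * dcoeff l * dcoeff (n - 1 - l)
      = 4 * (real ((2 * n + 4) choose (2 * l + 3)) * fact (2 * l + 3) * fact (2 * n + 4 - (2 * l + 3)))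
         * ((-1) ^ l * (-1) ^ (n - 1 - l)) * (\<beta> (2 * l + 2) * \<beta> (2 * (n - l)))"
      unfolding d idx by (simp only: mult_ac)
    also have "real ((2 * n + 4) choose (2 * l + 3)) * fact (2 * l + 3) * fact (2 * n + 4 - (2 * l + 3)) = fact (2 * n + 4)"
      using that by (subst binomial_fact) auto
    finally show ?thesis unfolding sg by simp
  qed
  then have "(\<Sum>l<n. real ((2 * n + 4) choose (2 * l + 3)) * dcoeff l * dcoeff (n - 1 - l))
      = 4 * fact (2 * n + 4) * (-1) ^ (n - 1) * (\<Sum>l<n. \<beta> (2 * l + 2) * \<beta> (2 * (n - l)))"
    unfolding sum_distrib_left by (intro sum.cong) auto
  also have "\<dots> = 4 * fact (2 * n + 4) * ((-1) ^ (n - 1) * (-1)) * (2 * real n + 3) * \<beta> (2 * n + 2)"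
  proof -
    have "(\<Sum>l<n. \<beta> (2 * l + 2) * \<beta> (2 * (n - l))) = - (2 * real n + 3) * \<beta> (2 * n + 2)"
      unfolding \<beta>_def by (rule bernoulli_num_convolution[OF assms])
    then show ?thesis by (simp only: mult_minus_left mult_minus_right mult_1_right mult.assoc)
  qed
  also have "(-1 :: real) ^ (n - 1) * (-1) = (-1) ^ n"
    using assms by (cases n) auto
  also have "(fact (2 * n + 4) :: real) = (2 * real n + 4) * fact (2 * n + 3)"
    by (simp add: eval_nat_numeral algebra_simps)
  finally show ?thesis by (simp add: d algebra_simps)
qed

subsection \<open>Germs of meromorphic functions\<close>

lemma merom_germ_deriv: "merom_germ F \<Longrightarrow> merom_germ (fls_deriv F)"
  unfolding merom_germ_def by (blast intro: has_laurent_expansion_deriv)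

lemma merom_germ_const: "merom_germ (fls_const c)"
  unfolding merom_germ_def by blast

lemma merom_germ_X: "merom_germ fls_X"
  unfolding merom_germ_def by (blast intro: has_laurent_expansion_fps_X)

lemma merom_germ_compose:
  assumes "merom_germ F" "merom_germ (fps_to_fls G)" "fps_nth G 0 = 0" "G \<noteq> 0"
  shows "merom_germ (fls_compose_fps F G)"
  using assms has_laurent_expansion_compose unfolding merom_germ_def by blast

interpretation merom_germ: subfield_set "Collect merom_germ"
proof
  have 0: "merom_germ 0" and 1: "merom_germ 1"
    unfolding merom_germ_def by blast+
  show "0 \<in> Collect merom_germ" "1 \<in> Collect merom_germ" using 0 1 by auto
  fix F G assume "F \<in> Collect merom_germ" "G \<in> Collect merom_germ"
  then obtain f g where "f has_laurent_expansion F" "g has_laurent_expansion G"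
    by (auto simp: merom_germ_def)
  then show "F + G \<in> Collect merom_germ" "F * G \<in> Collect merom_germ" "- F \<in> Collect merom_germ"
      "inverse F \<in> Collect merom_germ"
    unfolding merom_germ_def mem_Collect_eq
    by (blast intro: has_laurent_expansion_add has_laurent_expansion_mult has_laurent_expansion_minus
        has_laurent_expansion_inverse)+
qed

lemma merom_germ_shift_series: "merom_germ (fps_to_fls shift_series)"
proof -
  have "fps_to_fls shift_series = fls_X + fls_X * fps_to_fls shift_series"
    using arg_cong[OF shift_series_eq, of fps_to_fls] by (simp add: fls_times_fps_to_fls)
  then have "fps_to_fls shift_series * (1 - fls_X) = fls_X" by (simp add: algebra_simps)
  moreover have "1 - fls_X \<noteq> (0 :: complex fls)"
  proof
    assume "1 - fls_X = (0 :: complex fls)"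
    then have "fls_nth (1 - fls_X :: complex fls) 0 = 0" by simp
    then show False by simp
  qed
  ultimately have "fps_to_fls shift_series = fls_X / (1 - fls_X)" by (simp add: field_simps)
  then show ?thesis
    using merom_germ.K_divide[of fls_X "1 - fls_X"] merom_germ.K_diff[of 1 fls_X] merom_germ.K_1 merom_germ_X
    by simp
qed

interpretation shift: difference_subfield "Collect merom_germ" "\<lambda>F. fls_compose_fps F shift_series"
proof
  show "F \<in> Collect merom_germ \<Longrightarrow> fls_compose_fps F shift_series \<in> Collect merom_germ" for F
    using merom_germ_compose[OF _ merom_germ_shift_series] by simp
qed (simp_all add: fls_compose_fps_add fls_compose_fps_mult)

text \<open>The shift is a field homomorphism, so for a series with a pole one passes to the
  inverse, which is again invariant and is a power series.\<close>

lemma fls_shift_invariant_imp_const: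
  assumes F: "fls_compose_fps F shift_series = F"
  shows "\<exists>c. F = fls_const c"
proof -
  have *: "\<exists>c. F = fls_const c" if F: "fls_compose_fps F shift_series = F" "fls_subdegree F \<ge> 0" for F
  proof -
    have P: "F = fps_to_fls (fls_regpart F)" using that by simp
    have "fps_to_fls (fls_regpart F oo shift_series) = fps_to_fls (fls_regpart F)"
      using F(1) by (subst (asm) (1 2) P) simp
    then have "fls_regpart F oo shift_series = fls_regpart F" by simp
    from shift_invariant_imp_const[OF this] P show ?thesis by (metis fps_const_to_fls)
  qed
  show ?thesis
  proof (cases "fls_subdegree F \<ge> 0")
    case False
    have "\<exists>c. inverse F = fls_const c"
      using False F by (intro *) (auto simp: fls_compose_fps_inverse)
    then obtain c where "inverse F = fls_const c" by blast
    then have "F = fls_const (inverse c)" by (metis fls_inverse_const inverse_inverse_eq)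
    then show ?thesis by blast
  qed (use F * in blast)
qed

subsection \<open>The derivatives of the Bernoulli series\<close>

text \<open>Differentiation with respect to $v = 1/u$, which commutes with the shift of $v$.\<close>

definition inv_deriv :: "complex fps \<Rightarrow> complex fps" where
  "inv_deriv F = - (fps_X\<^sup>2 * fps_deriv F)"

lemma inv_deriv_add: "inv_deriv (F + G) = inv_deriv F + inv_deriv G"
  by (simp add: inv_deriv_def algebra_simps)

lemma inv_deriv_pow_add: "(inv_deriv ^^ i) (F + G) = (inv_deriv ^^ i) F + (inv_deriv ^^ i) G"
  by (induction i) (simp_all add: inv_deriv_add)

text \<open>The chain rule reduces this to u^2 h' = h^2, which is dh/dv = -h^2 for h = 1/(v-1). It
  is checked after multiplication by 1 - u.\<close>

lemma inv_deriv_shift: "inv_deriv (F oo shift_series) = inv_deriv F oo shift_series"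
proof -
  let ?h = shift_series
  have Xh: "fps_X * ?h = ?h - fps_X" using shift_series_eq by (simp add: algebra_simps)
  have "fps_deriv ?h = 1 + (?h + fps_X * fps_deriv ?h)"
    by (subst (1) shift_series_eq) (simp add: algebra_simps)
  then have d: "(1 - fps_X) * fps_deriv ?h = 1 + ?h" by (simp add: algebra_simps)
  have "(1 - fps_X) * (fps_X\<^sup>2 * fps_deriv ?h) = fps_X * (fps_X * (1 + ?h))"
    unfolding d[symmetric] by (simp add: power2_eq_square mult_ac)
  also have "fps_X * (1 + ?h) = ?h" using shift_series_eq by (simp add: algebra_simps)
  also have "fps_X * ?h = (1 - fps_X) * ?h\<^sup>2"
  proof -
    have "(1 - fps_X) * ?h\<^sup>2 = ?h * (?h - fps_X * ?h)" by (simp add: power2_eq_square algebra_simps)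
    also have "?h - fps_X * ?h = fps_X" unfolding Xh by simp
    finally show ?thesis by (simp add: mult.commute)
  qed
  finally have "(1 - fps_X) * (fps_X\<^sup>2 * fps_deriv ?h) = (1 - fps_X) * ?h\<^sup>2" .
  moreover have "1 - fps_X \<noteq> (0 :: complex fps)"
  proof
    assume "1 - fps_X = (0 :: complex fps)"
    then have "fps_nth (1 - fps_X :: complex fps) 0 = 0" by simp
    then show False by simp
  qed
  ultimately have "fps_X\<^sup>2 * fps_deriv ?h = ?h\<^sup>2" by simp
  then show ?thesis
    by (simp add: inv_deriv_def fps_compose_deriv fps_compose_uminus fps_compose_mult_distrib
        fps_compose_power[symmetric] mult_ac)
qed

lemma inv_deriv_pow_shift: "(inv_deriv ^^ i) F oo shift_series = (inv_deriv ^^ i) (F oo shift_series)"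
  by (induction i) (simp_all add: inv_deriv_shift[symmetric])

lemma fps_to_fls_inv_deriv: "fps_to_fls (inv_deriv F) = - (fls_X\<^sup>2 * fls_deriv (fps_to_fls F))"
  by (simp add: inv_deriv_def fls_times_fps_to_fls fps_to_fls_power fls_deriv_fps_to_fls)

definition bernoulli_deriv :: "nat \<Rightarrow> complex fls" where
  "bernoulli_deriv i = fps_to_fls ((inv_deriv ^^ i) bernoulli_series)"

lemma bernoulli_deriv_Suc: "bernoulli_deriv (Suc i) = - (fls_X\<^sup>2 * fls_deriv (bernoulli_deriv i))"
  by (simp add: bernoulli_deriv_def fps_to_fls_inv_deriv)

lemma merom_germ_inv_deriv_pow:
  assumes "merom_germ (fps_to_fls F)"
  shows "merom_germ (fps_to_fls ((inv_deriv ^^ i) F))"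
proof (induction i)
  case (Suc i)
  then have "fls_deriv (fps_to_fls ((inv_deriv ^^ i) F)) \<in> Collect merom_germ"
    by (simp add: merom_germ_deriv)
  then have "- (fls_X\<^sup>2 * fls_deriv (fps_to_fls ((inv_deriv ^^ i) F))) \<in> Collect merom_germ"
    using merom_germ_X by (intro merom_germ.K_minus merom_germ.K_mult merom_germ.K_power) auto
  then show ?case by (simp add: fps_to_fls_inv_deriv)
qed (use assms in simp)

text \<open>The increments are the v-derivatives of 2 u^3, hence germs: this is the input of
  Ostrowski's argument.\<close>

lemma bernoulli_deriv_shift:
  "\<exists>b. (\<forall>i. fls_compose_fps (bernoulli_deriv i) shift_series = bernoulli_deriv i + b i) \<and> (\<forall>i. b i \<in> Collect merom_germ)"
proof (intro exI conjI allI)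
  let ?b = "\<lambda>i. fps_to_fls ((inv_deriv ^^ i) (fps_const 2 * fps_X ^ 3))"
  show "fls_compose_fps (bernoulli_deriv i) shift_series = bernoulli_deriv i + ?b i" for i
    by (simp add: bernoulli_deriv_def inv_deriv_pow_shift bernoulli_series_shift inv_deriv_pow_add)
  have "of_nat 2 * fls_X ^ 3 \<in> Collect merom_germ"
    using merom_germ_X by (intro merom_germ.K_mult merom_germ.K_power merom_germ.K_of_nat) auto
  then show "?b i \<in> Collect merom_germ" for i
    using merom_germ_inv_deriv_pow[of "fps_const 2 * fps_X ^ 3"]
    by (simp add: fls_times_fps_to_fls fps_to_fls_power)
qed

text \<open>Formal Borel transform: dividing the coefficients by factorials turns the Bernoulli series
  into $x^2/(e^x-1)$ and the derivation into multiplication by $-x$.\<close>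

definition bernoulli_egf_complex :: "complex fps" where
  "bernoulli_egf_complex = Abs_fps (\<lambda>n. of_real (fps_nth bernoulli_egf n))"

lemma bernoulli_egf_complex_mult: "bernoulli_egf_complex * (fps_exp 1 - 1) = fps_X"
proof (rule fps_ext)
  fix n
  have "fps_nth (fps_exp 1 - 1) k = complex_of_real (fps_nth (fps_exp 1 - 1) k)" for k
    by (simp add: fps_one_nth)
  then have "fps_nth (bernoulli_egf_complex * (fps_exp 1 - 1)) n
      = of_real (fps_nth (bernoulli_egf * (fps_exp 1 - 1)) n)"
    by (simp add: fps_mult_nth bernoulli_egf_complex_def del: fps_sub_nth)
  then show "fps_nth (bernoulli_egf_complex * (fps_exp 1 - 1)) n = fps_nth fps_X n"
    unfolding bernoulli_egf_mult by (simp add: fps_X_nth)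
qed

text \<open>The transform sends u^(n+1) to x^n/n!. The derivation maps u^(n+1) to -(n+1) u^(n+2),
  whose image is -x times x^n/n!.\<close>

lemma inv_deriv_bernoulli_nth:
  "fps_nth ((inv_deriv ^^ i) bernoulli_series) (Suc n)
    = fact n * fps_nth (fps_const ((-1) ^ i) * fps_X ^ Suc i * bernoulli_egf_complex) n"
proof (induction i arbitrary: n)
  case 0
  show ?case
    by (cases n) (simp_all add: bernoulli_series_def bernoulli_egf_complex_def bernoulli_num_eq)
next
  case (Suc i)
  show ?case
  proof (cases n)
    case 0
    then show ?thesis by (simp add: inv_deriv_def power2_eq_square mult.assoc)
  next
    case (Suc k)
    let ?F = "(inv_deriv ^^ i) bernoulli_series"
    have "fps_nth ((inv_deriv ^^ Suc i) bernoulli_series) (Suc n) = - (of_nat (Suc k) * fps_nth ?F (Suc k))"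
      by (simp add: inv_deriv_def power2_eq_square mult.assoc Suc)
    also have "\<dots> = - (fact n * fps_nth (fps_const ((-1) ^ i) * fps_X ^ Suc i * bernoulli_egf_complex) k)"
      unfolding Suc.IH by (simp add: Suc)
    also have "\<dots> = fact n * fps_nth (fps_const ((-1) ^ Suc i) * fps_X ^ Suc (Suc i) * bernoulli_egf_complex) n"
      by (simp add: Suc mult.assoc)
    finally show ?thesis .
  qed
qed

text \<open>A geometric bound for the coefficients of \<open>F\<close> becomes an exponential series
  bound for those of \<open>E\<close>.\<close>

lemma conv_radius_borel:
  fixes F E :: "complex fps"
  assumes F: "fps_conv_radius F > 0" and E: "\<And>n. fps_nth F (Suc n) = fact n * fps_nth E n"
  shows "fps_conv_radius E = \<infinity>"
  unfolding fps_conv_radius_def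
proof (rule conv_radius_inftyI'')
  fix z :: complex
  obtain r where r: "0 < ereal r" "ereal r < fps_conv_radius F" using F ereal_dense2 by blast
  then have "r > 0" by simp
  have "summable (\<lambda>n. fps_nth F n * of_real r ^ n)"
    using r by (intro summable_in_conv_radius) (auto simp: fps_conv_radius_def)
  then have "Bseq (\<lambda>n. fps_nth F n * of_real r ^ n)"
    by (intro convergent_imp_Bseq convergentI) (rule summable_LIMSEQ_zero)
  then obtain M where M: "\<And>n. norm (fps_nth F n * of_real r ^ n) \<le> M"
    by (auto simp: Bseq_def)
  have "summable (\<lambda>n. (M / r) * ((norm z / r) ^ n / fact n))"
    using summable_exp[of "norm z / r"] by (intro summable_mult) (simp add: field_simps)
  then show "summable (\<lambda>n. fps_nth E n * z ^ n)"
  proof (rule summable_comparison_test'[where N = 0])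
    fix n
    have "norm (fps_nth F (Suc n)) \<le> M / r ^ Suc n"
      using M[of "Suc n"] \<open>r > 0\<close> by (simp add: norm_mult norm_power field_simps)
    then have "norm (fps_nth E n) * fact n \<le> M / r ^ Suc n"
      unfolding E by (simp add: norm_mult mult.commute)
    then have "norm (fps_nth E n) \<le> M / r ^ Suc n / fact n"
      by (subst pos_le_divide_eq) auto
    then have "norm (fps_nth E n) * norm z ^ n \<le> M / r ^ Suc n / fact n * norm z ^ n"
      by (intro mult_right_mono) auto
    then show "norm (fps_nth E n * z ^ n) \<le> (M / r) * ((norm z / r) ^ n / fact n)"
      by (simp add: norm_mult norm_power power_divide field_simps)
  qed
qed

text \<open>A convergent combination would make $p(x)\,x/(e^x-1)$ entire, so the polynomial $p$ would
  vanish at every $2\pi i k$ with $k \ge 1$.\<close>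

lemma bernoulli_derivs_independent:
  assumes conv: "fps_conv_radius (\<Sum>i\<le>m. fps_const (\<alpha> i) * (inv_deriv ^^ i) bernoulli_series) > 0"
    and "i \<le> m"
  shows "\<alpha> i = 0"
proof -
  define p where "p = (\<Sum>i\<le>m. monom (\<alpha> i * (-1) ^ i) (Suc i))"
  define E where "E = fps_of_poly p * bernoulli_egf_complex"
  have p: "fps_of_poly p = (\<Sum>i\<le>m. fps_const (\<alpha> i) * (fps_const ((-1) ^ i) * fps_X ^ Suc i))"
    by (simp add: p_def fps_of_poly_sum fps_of_poly_monom mult.assoc[symmetric] del: power_Suc)
  have "fps_nth (\<Sum>i\<le>m. fps_const (\<alpha> i) * (inv_deriv ^^ i) bernoulli_series) (Suc n) = fact n * fps_nth E n" for n
    unfolding E_def p sum_distrib_right fps_sum_nth sum_distrib_left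
    by (intro sum.cong refl) (simp add: inv_deriv_bernoulli_nth mult.assoc mult.left_commute[of _ "fact n"] del: power_Suc)
  then have rad: "fps_conv_radius E = \<infinity>" by (rule conv_radius_borel[OF conv])
  \<comment> \<open>Evaluate E (e^z - 1) = p(z) z at a zero of e^z - 1. Using \<open>Suc k\<close>
    avoids z = 0, so the factor z can be cancelled.\<close>
  have "poly p (2 * of_real pi * \<i> * of_nat (Suc k)) = 0" for k
  proof -
    let ?z = "2 * of_real pi * \<i> * of_nat (Suc k) :: complex"
    have "E * (fps_exp 1 - 1) = fps_of_poly p * fps_X"
      unfolding E_def mult.assoc bernoulli_egf_complex_mult ..
    then have "eval_fps (E * (fps_exp 1 - 1)) ?z = eval_fps (fps_of_poly p * fps_X) ?z" by simp
    moreover have "eval_fps (fps_of_poly p * fps_X) ?z = poly p ?z * ?z"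
      by (subst eval_fps_mult) auto
    moreover have rad2: "fps_conv_radius (fps_exp 1 - 1 :: complex fps) = \<infinity>"
      using fps_conv_radius_diff[of "fps_exp 1 :: complex fps" 1] by simp
    have "eval_fps (E * (fps_exp 1 - 1)) ?z = eval_fps E ?z * (exp ?z - 1)"
      by (subst eval_fps_mult) (auto simp: rad rad2 eval_fps_diff)
    moreover have "exp ?z = 1"
      unfolding exp_eq_1 by (auto intro!: exI[of _ "int (Suc k)"])
    ultimately have "poly p ?z * ?z = 0" by simp
    then show ?thesis by (simp del: of_nat_Suc)
  qed
  then have "range (\<lambda>k. 2 * of_real pi * \<i> * of_nat (Suc k)) \<subseteq> {z. poly p z = 0}" by auto
  moreover have "infinite (range (\<lambda>k. 2 * of_real pi * \<i> * of_nat (Suc k) :: complex))"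
    by (rule range_inj_infinite) (auto simp: inj_def)
  ultimately have "infinite {z. poly p z = 0}" using finite_subset by blast
  then have "p = 0" using poly_roots_finite by blast
  then have "coeff p (Suc i) = 0" by simp
  moreover have "coeff p (Suc i) = \<alpha> i * (-1) ^ i"
    using \<open>i \<le> m\<close> by (simp add: p_def coeff_sum)
  ultimately show ?thesis by simp
qed

lemma bernoulli_derivs_algebraically_independent:
  "\<not> algebraic_relation (Collect merom_germ) m bernoulli_deriv c"
proof
  assume rel: "algebraic_relation (Collect merom_germ) m bernoulli_deriv c"
  let ?\<tau> = "\<lambda>F. fls_compose_fps F shift_series"
  obtain b where b: "\<And>i. ?\<tau> (bernoulli_deriv i) = bernoulli_deriv i + b i"
      "\<And>i. b i \<in> Collect merom_germ"
    using bernoulli_deriv_shift by blast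
  from shift.linear_relation_of_algebraic_relation[OF rel b]
  obtain a g where a: "\<forall>i\<le>m. a i \<in> Collect merom_germ \<and> ?\<tau> (a i) = a i" "\<exists>i\<le>m. a i \<noteq> 0"
    and g: "g \<in> Collect merom_germ" "(\<Sum>i\<le>m. a i * b i) = ?\<tau> g - g"
    by blast
  have "\<forall>i\<in>{..m}. \<exists>x. a i = fls_const x" using a(1) fls_shift_invariant_imp_const by blast
  then obtain \<alpha> where \<alpha>: "\<And>i. i \<le> m \<Longrightarrow> a i = fls_const (\<alpha> i)" by (metis atMost_iff)
  define F where "F = (\<Sum>i\<le>m. fps_const (\<alpha> i) * (inv_deriv ^^ i) bernoulli_series)"
  have to_fls_sum: "fps_to_fls (sum G A) = (\<Sum>i\<in>A. fps_to_fls (G i))" for G :: "nat \<Rightarrow> complex fps" and A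
    by (induction A rule: infinite_finite_induct) auto
  have F: "fps_to_fls F = (\<Sum>i\<le>m. a i * bernoulli_deriv i)"
    unfolding F_def to_fls_sum
    by (intro sum.cong) (auto simp: \<alpha> bernoulli_deriv_def fls_times_fps_to_fls)
  have "?\<tau> (fps_to_fls F) = (\<Sum>i\<le>m. a i * bernoulli_deriv i) + (\<Sum>i\<le>m. a i * b i)"
    unfolding F shift.\<tau>_sum shift.\<tau>_mult sum.distrib[symmetric]
    using a(1) by (intro sum.cong) (auto simp: b algebra_simps)
  then have "?\<tau> (fps_to_fls F - g) = fps_to_fls F - g"
    using g(2) by (simp add: F fls_compose_fps_diff)
  then obtain x where "fps_to_fls F - g = fls_const x"
    using fls_shift_invariant_imp_const by blast
  then have "fps_to_fls F = fls_const x + g" by (simp add: algebra_simps)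
  then have "merom_germ (fps_to_fls F)"
    using merom_germ.K_add[of "fls_const x" g] g(1) merom_germ_const by simp
  then have "fps_conv_radius F > 0"
    by (auto simp: merom_germ_def has_laurent_expansion_def)
  then have "\<alpha> i = 0" if "i \<le> m" for i
    using bernoulli_derivs_independent that unfolding F_def by blast
  then show False using a(2) \<alpha> by auto
qed

subsection \<open>Differential transcendence\<close>

definition unit_index :: "nat \<Rightarrow> nat \<Rightarrow> nat" where
  "unit_index j = inc (\<lambda>_. 0) j"

lemma weight_unit_index: "j \<le> m \<Longrightarrow> weight m \<omega> (unit_index j) = \<omega> j"
  using weight_inc[of j m \<omega> "\<lambda>_. 0"] by (simp add: unit_index_def weight_def[of m \<omega> "\<lambda>_. 0"])

lemma monom_at_unit_index: "j \<le> m \<Longrightarrow> monom_at m f (unit_index j) = f j"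
  using monom_at_inc[of j m f "\<lambda>_. 0"] by (simp add: unit_index_def)

lemma unit_index_multi_index: "j \<le> m \<Longrightarrow> unit_index j \<in> multi_index m"
  by (auto simp: unit_index_def multi_index_def)

section \<open>From derivatives in x to derivatives in v\<close>

definition affine_indices :: "nat \<Rightarrow> (nat \<Rightarrow> nat) set" where
  "affine_indices i = insert (\<lambda>_. 0) (unit_index ` {..<i})"

text \<open>With weight j+1 for variable j, affine expressions in the variables before the i-th
  count as lower terms for it, as \<open>algebraic_relation_triangular\<close> requires.\<close>

lemma affine_indices_weight:
  "i \<le> m \<Longrightarrow> affine_indices i \<subseteq> {\<alpha> \<in> multi_index m. weight m Suc \<alpha> < Suc i}"
  by (auto simp: affine_indices_def weight_unit_index unit_index_multi_index)
     (auto simp: weight_def multi_index_def)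

abbreviation bernoulli_affine :: "nat \<Rightarrow> nat \<Rightarrow> complex fls set" where
  "bernoulli_affine m i \<equiv> merom_germ.monom_span m bernoulli_deriv (affine_indices i)"

lemma fls_deriv_bernoulli_deriv: "fls_deriv (bernoulli_deriv j) = - (inverse (fls_X\<^sup>2) * bernoulli_deriv (Suc j))"
proof -
  have *: "b = - (x * d) \<Longrightarrow> x \<noteq> 0 \<Longrightarrow> d = - (inverse x * b)" for b d x :: "complex fls" by simp
  show ?thesis by (rule *[OF bernoulli_deriv_Suc]) simp
qed

lemma bernoulli_affine_const: "merom_germ x \<Longrightarrow> x \<in> bernoulli_affine m i"
  using merom_germ.monom_span_base[of x "\<lambda>_. 0" "affine_indices i" m bernoulli_deriv]
  by (simp add: affine_indices_def)

lemma bernoulli_affine_base: "merom_germ x \<Longrightarrow> j < i \<Longrightarrow> i \<le> Suc m \<Longrightarrow> x * bernoulli_deriv j \<in> bernoulli_affine m i"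
  using merom_germ.monom_span_base[of x "unit_index j" "affine_indices i" m bernoulli_deriv]
  by (simp add: affine_indices_def monom_at_unit_index)

text \<open>d/du is -u^(-2) d/dv, and u^(-2) is a germ, so differentiating in u raises the order by
  one and stays affine.\<close>

lemma bernoulli_affine_deriv:
  assumes "x \<in> bernoulli_affine m i" "i \<le> m"
  shows "fls_deriv x \<in> bernoulli_affine m (Suc i)"
  using assms(1)
proof (induction rule: merom_germ.monom_span.induct)
  case zero
  show ?case by (simp add: merom_germ.monom_span.zero)
next
  case (step k \<alpha> x)
  have k: "merom_germ k" "merom_germ (fls_deriv k)" using step.hyps(1) merom_germ_deriv by auto
  have "fls_deriv (k * monom_at m bernoulli_deriv \<alpha>) \<in> bernoulli_affine m (Suc i)"
  proof (cases "\<alpha> = (\<lambda>_. 0)")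
    case True
    then show ?thesis using k by (simp add: bernoulli_affine_const)
  next
    case False
    then obtain j where j: "j < i" "\<alpha> = unit_index j" using step.hyps(2) by (auto simp: affine_indices_def)
    have c: "- (k * inverse (fls_X\<^sup>2)) \<in> Collect merom_germ"
      using k merom_germ_X
      by (intro merom_germ.K_minus merom_germ.K_mult merom_germ.K_inverse merom_germ.K_power) auto
    have "fls_deriv (k * monom_at m bernoulli_deriv \<alpha>)
        = fls_deriv k * bernoulli_deriv j + - (k * inverse (fls_X\<^sup>2)) * bernoulli_deriv (Suc j)"
      using j assms(2) by (simp add: monom_at_unit_index fls_deriv_bernoulli_deriv algebra_simps)
    also have "\<dots> \<in> bernoulli_affine m (Suc i)"
      using j assms(2) k c by (intro merom_germ.monom_span_add bernoulli_affine_base) auto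
    finally show ?thesis .
  qed
  then show ?case
    using merom_germ.monom_span_add step.IH by (simp del: fls_deriv_mult)
qed

text \<open>With $x = -u^2$ one has $d/dx = -(2u)^{-1} d/du$, so the derivatives of the series in $x$
  are triangular combinations of the derivatives of the Bernoulli series with respect to $1/u$.\<close>

lemma deriv_triangular:
  fixes Q :: "complex fps"
  assumes Q: "fps_X ^ 4 * (Q oo (- (fps_X\<^sup>2))) = 2 * bernoulli_series - 2 * fps_X\<^sup>2 + 2 * fps_X ^ 3"
    and "i \<le> m"
  shows "\<exists>k l. k \<in> Collect merom_germ \<and> k \<noteq> 0 \<and> l \<in> bernoulli_affine m i \<and>
    fps_to_fls ((fps_deriv ^^ i) Q oo (- (fps_X\<^sup>2))) = k * bernoulli_deriv i + l"
  using assms(2)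
proof (induction i)
  case 0
  let ?q = "fps_to_fls (Q oo (- (fps_X\<^sup>2)))"
  define k :: "complex fls" where "k = of_nat 2 * inverse (fls_X ^ 4)"
  define l :: "complex fls" where "l = inverse (fls_X ^ 4) * (of_nat 2 * fls_X ^ 3 - of_nat 2 * fls_X ^ 2)"
  have X: "fls_X \<in> Collect merom_germ" using merom_germ_X by simp
  have "fls_X ^ 4 * ?q = 2 * bernoulli_deriv 0 - 2 * fls_X\<^sup>2 + 2 * fls_X ^ 3"
    using arg_cong[OF Q, of fps_to_fls] by (simp add: bernoulli_deriv_def fls_times_fps_to_fls fps_to_fls_power)
  moreover have "x * q = t \<Longrightarrow> x \<noteq> 0 \<Longrightarrow> q = inverse x * t" for x q t :: "complex fls" by auto
  ultimately have "?q = inverse (fls_X ^ 4) * (2 * bernoulli_deriv 0 - 2 * fls_X\<^sup>2 + 2 * fls_X ^ 3)"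
    by (metis fls_X_pow_nonzero)
  also have "\<dots> = k * bernoulli_deriv 0 + l"
    by (simp add: k_def l_def algebra_simps)
  finally have "?q = k * bernoulli_deriv 0 + l" .
  moreover have "k \<in> Collect merom_germ"
    unfolding k_def by (intro merom_germ.K_mult merom_germ.K_inverse merom_germ.K_power merom_germ.K_of_nat X)
  moreover have "l \<in> Collect merom_germ"
    unfolding l_def
    by (intro merom_germ.K_diff merom_germ.K_mult merom_germ.K_inverse merom_germ.K_power merom_germ.K_of_nat X)
  moreover have "k \<noteq> 0" by (simp add: k_def)
  ultimately show ?case using bernoulli_affine_const by auto
next
  case (Suc i)
  define G where "G j = fps_to_fls ((fps_deriv ^^ j) Q oo (- (fps_X\<^sup>2)))" for j
  obtain k l where k: "k \<in> Collect merom_germ" "k \<noteq> 0" and l: "l \<in> bernoulli_affine m i"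
    and G: "G i = k * bernoulli_deriv i + l"
    using Suc unfolding G_def by auto
  have "fps_deriv ((fps_deriv ^^ i) Q oo (- (fps_X\<^sup>2)))
      = ((fps_deriv ^^ Suc i) Q oo (- (fps_X\<^sup>2))) * (- (2 * fps_X))"
    by (subst fps_compose_deriv) (simp_all add: power2_eq_square)
  then have "fls_deriv (G i) = G (Suc i) * (- (2 * fls_X))"
    unfolding G_def fls_deriv_fps_to_fls by (simp add: fls_times_fps_to_fls)
  define w :: "complex fls" where "w = - inverse (of_nat 2 * fls_X)"
  have X: "fls_X \<in> Collect merom_germ" using merom_germ_X by simp
  have w: "w \<in> Collect merom_germ" "w \<noteq> 0"
    unfolding w_def by (intro merom_germ.K_minus merom_germ.K_mult merom_germ.K_inverse merom_germ.K_of_nat X) simp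
  have "g = - inverse (of_nat 2 * x) * (g * (- (2 * x)))" if "x \<noteq> 0" for g x :: "complex fls"
    using that by (simp add: field_simps)
  then have "G (Suc i) = w * fls_deriv (G i)"
    unfolding \<open>fls_deriv (G i) = _\<close> w_def using fls_X_nonzero by blast
  also have "\<dots> = (w * (- (k * inverse (fls_X\<^sup>2)))) * bernoulli_deriv (Suc i)
      + w * (fls_deriv k * bernoulli_deriv i + fls_deriv l)"
    unfolding G by (simp add: fls_deriv_bernoulli_deriv algebra_simps)
  finally have "G (Suc i) = \<dots>" .
  moreover have "w * (- (k * inverse (fls_X\<^sup>2))) \<in> Collect merom_germ"
    by (intro merom_germ.K_mult merom_germ.K_minus merom_germ.K_inverse merom_germ.K_power X w k)
  moreover have "w * (- (k * inverse (fls_X\<^sup>2))) \<noteq> 0" using w k by simp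
  moreover have "w * (fls_deriv k * bernoulli_deriv i + fls_deriv l) \<in> bernoulli_affine m (Suc i)"
    using Suc.prems k merom_germ_deriv
    by (intro merom_germ.monom_span_scale merom_germ.monom_span_add w bernoulli_affine_base
        bernoulli_affine_deriv l) auto
  ultimately show ?case unfolding G_def by blast
qed

text \<open>Substituting x = -u^2 is injective and preserves germs, so a relation for
  \<open>Q\<close> becomes a nontrivial one for the pulled-back derivatives \<open>G\<close>. The
  triangular change of variables turns it into a forbidden relation for
  \<open>bernoulli_deriv\<close>.\<close>

lemma strongly_diff_transcendentalI:
  fixes Q :: "complex fps"
  assumes Q: "fps_X ^ 4 * (Q oo (- (fps_X\<^sup>2))) = 2 * bernoulli_series - 2 * fps_X\<^sup>2 + 2 * fps_X ^ 3"
  shows "strongly_diff_transcendental Q"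
  unfolding strongly_diff_transcendental_def
proof (intro notI, elim exE conjE)
  fix m c \<alpha>0
  assume fin: "finite {\<alpha>. c \<alpha> \<noteq> 0}" and supp: "\<forall>\<alpha>. c \<alpha> \<noteq> 0 \<longrightarrow> (\<forall>i>m. \<alpha> i = 0)"
    and germ: "\<forall>\<alpha>. merom_germ (c \<alpha>)" and nz: "c \<alpha>0 \<noteq> 0" and eval: "diff_poly_eval m c Q = 0"
  let ?x = "- (fps_X\<^sup>2) :: complex fps"
  define \<sigma> where "\<sigma> F = fls_compose_fps F ?x" for F
  have x: "?x \<noteq> 0" "fps_nth ?x 0 = 0" by simp_all
  have germ_x: "merom_germ (fps_to_fls ?x)"
    using merom_germ.K_minus[OF merom_germ.K_power[of fls_X 2]] merom_germ_X by (simp add: fps_to_fls_power)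
  interpret \<sigma>: difference_subfield "Collect merom_germ" \<sigma>
    by unfold_locales
       (use merom_germ_compose[OF _ germ_x] x in \<open>auto simp: \<sigma>_def fls_compose_fps_add fls_compose_fps_mult\<close>)
  define G where "G i = fps_to_fls ((fps_deriv ^^ i) Q oo ?x)" for i
  have \<sigma>_pow: "\<sigma> (F ^ n) = \<sigma> F ^ n" for F n
    by (induction n) (auto simp: \<sigma>.\<tau>_1 \<sigma>.\<tau>_mult)
  have \<sigma>_prod: "\<sigma> (prod F A) = (\<Prod>i\<in>A. \<sigma> (F i))" for F :: "nat \<Rightarrow> complex fls" and A
    by (induction A rule: infinite_finite_induct) (auto simp: \<sigma>.\<tau>_1 \<sigma>.\<tau>_mult)
  have "\<sigma> (fps_to_fls ((fps_deriv ^^ i) Q)) = G i" for i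
    using x by (simp add: \<sigma>_def G_def)
  then have "\<sigma> (diff_poly_eval m c Q) = (\<Sum>\<alpha> | c \<alpha> \<noteq> 0. \<sigma> (c \<alpha>) * monom_at m G \<alpha>)"
    by (simp add: diff_poly_eval_def \<sigma>.\<tau>_sum \<sigma>.\<tau>_mult \<sigma>_prod \<sigma>_pow monom_at_def)
  then have 0: "(\<Sum>\<alpha> | c \<alpha> \<noteq> 0. \<sigma> (c \<alpha>) * monom_at m G \<alpha>) = 0"
    unfolding eval by (simp add: \<sigma>.\<tau>_0)
  have \<sigma>_0: "\<sigma> F = 0 \<longleftrightarrow> F = 0" for F
    unfolding \<sigma>_def using x by (rule fls_compose_fps_eq_0_iff)
  have "algebraic_relation (Collect merom_germ) m G (\<lambda>\<alpha>. \<sigma> (c \<alpha>))"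
    using fin supp germ nz 0 \<sigma>.\<tau>_K
    unfolding algebraic_relation_def \<sigma>_0 by (auto simp: multi_index_def)
  moreover have "\<forall>i\<in>{..m}. \<exists>k l. k \<in> Collect merom_germ \<and> k \<noteq> 0 \<and> l \<in> bernoulli_affine m i \<and>
      G i = k * bernoulli_deriv i + l"
    unfolding G_def using deriv_triangular[OF Q] by blast
  then obtain k l where kl: "\<And>i. i \<le> m \<Longrightarrow> k i \<in> Collect merom_germ" "\<And>i. i \<le> m \<Longrightarrow> k i \<noteq> 0"
      "\<And>i. i \<le> m \<Longrightarrow> l i \<in> bernoulli_affine m i" "\<And>i. i \<le> m \<Longrightarrow> G i = k i * bernoulli_deriv i + l i"
    unfolding bchoice_iff by (metis atMost_iff)
  have "l i \<in> merom_germ.monom_span m bernoulli_deriv {\<alpha> \<in> multi_index m. weight m Suc \<alpha> < Suc i}" if "i \<le> m" for i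
    using merom_germ.monom_span_mono[OF kl(3)[OF that] affine_indices_weight[OF that]] .
  ultimately obtain d where "algebraic_relation (Collect merom_germ) m bernoulli_deriv d"
    using merom_germ.algebraic_relation_triangular[of m G "\<lambda>\<alpha>. \<sigma> (c \<alpha>)" Suc k bernoulli_deriv l] kl
    by blast
  then show False using bernoulli_derivs_algebraically_independent by blast
qed

lemma Q_D_Bernoulli: "fps_X ^ 4 * (Q_D oo (- (fps_X\<^sup>2))) = 2 * bernoulli_series - 2 * fps_X\<^sup>2 + 2 * fps_X ^ 3"
proof -
  have w: "walk_gf_x = fps_X\<^sup>2 * Q_D"
    by (rule fps_ext)
       (auto simp: walk_gf_x_def Q_D_def dcoeff_def walk_weight_def fps_X_power_mult_nth)
  have p: "fps_X\<^sup>2 oo (- (fps_X\<^sup>2)) = (fps_X ^ 4 :: complex fps)"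
    by (simp add: fps_compose_power[symmetric] flip: power_mult)
  have "walk_gf_x oo (- (fps_X\<^sup>2)) = fps_X ^ 4 * (Q_D oo (- (fps_X\<^sup>2)))"
    unfolding w by (subst fps_compose_mult_distrib) (simp_all add: p)
  then show ?thesis using walk_gf_eq_bernoulli_series by simp
qed

theorem theorem5p3:
  shows "(\<forall>i. summable (\<lambda>n. real (walks_D n i 0) / 2 ^ n))
    \<and> Q_D = Abs_fps (\<lambda>n. complex_of_real
                 (2 * (2 * real n + 3) * bernoulli_num (2 * n + 2) * (-1) ^ n))
    \<and> strongly_diff_transcendental Q_D
    \<and> (\<forall>n\<ge>1. 4 * (real n + 2) * (2 * real n + 3) * dcoeff n
          = (\<Sum>l<n. real ((2 * n + 4) choose (2 * l + 3)) * dcoeff l * dcoeff (n - 1 - l)))"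
proof (intro conjI allI impI)
  show "summable (\<lambda>n. real (walks_D n i 0) / 2 ^ n)" for i by (rule summable_walks_D)
  show "Q_D = Abs_fps (\<lambda>n. complex_of_real (2 * (2 * real n + 3) * bernoulli_num (2 * n + 2) * (-1) ^ n))"
    unfolding Q_D_def dcoeff_eq_bernoulli ..
  show "strongly_diff_transcendental Q_D" by (rule strongly_diff_transcendentalI[OF Q_D_Bernoulli])
qed (rule dcoeff_convolution)

end
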